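(* For every $\varepsilon>0$, there is a $(1+\varepsilon)$-approximate Turing kernelization for \textsc{Dominating Set} parameterized by $\mathrm{tw}+\Delta$ whose oracle queries are graphs with $\mathcal{O}(\frac{1+\varepsilon}{\varepsilon}\cdot \mathrm{tw}\cdot\Delta)$ vertices.
   Context: \textsc{Dominating Set}: given a graph $G=(V,E)$, find a minimum-size $X\subseteq V$ with $N[X]=V$. $\mathrm{tw}$ is the treewidth and $\Delta$ the maximum degree of the input graph. The algorithm receives as input the graph $G$ together with a nice tree decomposition of width $\mathrm{tw}(G)$ (a rooted tree decomposition whose root and leaf bags are empty and every other node is a forget node, an introduce node, or a join node). A $(1+\varepsilon)$-approximate Turing kernelization is a polynomial-time algorithm that, with access to an oracle returning in a single step a $c$-approximate solution (one of size at most $c$ times the optimum) for any instance of bounded size (here: graphs with the stated number of vertices), outputs a $c(1+\varepsilon)$-approximate solution for the input, without knowing or depending on $c$. *)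

theory Defs
  imports "Graph_Theory.Digraph_Component" "HOL-Computational_Algebra.Polynomial"
begin

section \<open>Graphs and dominating sets\<close>

text \<open>
  A finite simple undirected graph is a value of type \<^typ>\<open>'a pair_pre_digraph\<close> satisfying
  \<^const>\<open>pair_graph\<close>: finite, loop-free, with a symmetric arc set, so that every undirected
  edge is present as two opposite arcs. The null graph is included.
\<close>

definition max_degree :: "'a pair_pre_digraph \<Rightarrow> nat" where
  "max_degree G = Max (insert 0 (out_degree (with_proj G) ` pverts G))"

definition closed_nbhd :: "'a pair_pre_digraph \<Rightarrow> 'a set \<Rightarrow> 'a set" where
  "closed_nbhd G X = X \<union> {v. \<exists>x\<in>X. (x, v) \<in> parcs G}"

definition dominating_set :: "'a pair_pre_digraph \<Rightarrow> 'a set \<Rightarrow> bool" where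
  "dominating_set G X \<longleftrightarrow> X \<subseteq> pverts G \<and> closed_nbhd G X = pverts G"

definition domination_number :: "'a pair_pre_digraph \<Rightarrow> nat" where
  "domination_number G = (LEAST n. \<exists>X. dominating_set G X \<and> card X = n)"


section \<open>Tree decompositions and treewidth\<close>

text \<open>
  The library's \<^const>\<open>tree\<close> is not usable here: in a symmetric digraph, a walk back and
  forth along one edge counts as a \<^const>\<open>pre_digraph.cycle\<close>. The cycles of length at least 3
  are exactly those of the undirected graph.
\<close>

definition undirected_tree :: "'a pair_pre_digraph \<Rightarrow> bool" where
  "undirected_tree T \<longleftrightarrow> pair_graph T \<and> Digraph_Component.connected (with_proj T) \<and>
     \<not> (\<exists>p. pre_digraph.cycle (with_proj T) p \<and> 3 \<le> length p)"

definition tree_decomposition ::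
    "'a pair_pre_digraph \<Rightarrow> 'b pair_pre_digraph \<Rightarrow> ('b \<Rightarrow> 'a set) \<Rightarrow> bool" where
  "tree_decomposition G T \<beta> \<longleftrightarrow> undirected_tree T \<and>
     (\<Union>s\<in>pverts T. \<beta> s) = pverts G \<and>
     (\<forall>(u, v)\<in>parcs G. \<exists>s\<in>pverts T. u \<in> \<beta> s \<and> v \<in> \<beta> s) \<and>
     (\<forall>v\<in>pverts G. Digraph_Component.connected (with_proj T \<restriction> {s \<in> pverts T. v \<in> \<beta> s}))"

text \<open>
  Subtraction on \<^typ>\<open>nat\<close> truncates: the null graph gets treewidth 0 rather than -1.
\<close>

definition decomposition_width :: "'b pair_pre_digraph \<Rightarrow> ('b \<Rightarrow> 'a set) \<Rightarrow> nat" where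
  "decomposition_width T \<beta> = Max ((\<lambda>s. card (\<beta> s)) ` pverts T) - 1"

text \<open>
  Every finite tree is isomorphic to one whose nodes are natural numbers.
\<close>

definition treewidth :: "'a pair_pre_digraph \<Rightarrow> nat" where
  "treewidth G = (LEAST k. \<exists>(T :: nat pair_pre_digraph) \<beta>.
     tree_decomposition G T \<beta> \<and> decomposition_width T \<beta> = k)"


section \<open>Nice tree decompositions\<close>

text \<open>
  Rooted trees, here labelled with bags. A node is addressed by the list of child indices
  leading to it from the root; \<open>tree_graph\<close> is the underlying undirected tree on these addresses.
\<close>

datatype 'a rtree = Node (label: 'a) (children: "'a rtree list")

primrec nodes :: "'a rtree \<Rightarrow> nat list set" where
  "nodes (Node a ts) = insert [] (\<Union>i<length ts. (#) i ` (map nodes ts ! i))"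

primrec subtree :: "nat list \<Rightarrow> 'a rtree \<Rightarrow> 'a rtree" where
  "subtree [] t = t"
| "subtree (i # p) t = subtree p (children t ! i)"

definition node_label :: "'a rtree \<Rightarrow> nat list \<Rightarrow> 'a" where
  "node_label t p = label (subtree p t)"

definition tree_graph :: "'a rtree \<Rightarrow> nat list pair_pre_digraph" where
  "tree_graph t =
    \<lparr>pverts = nodes t,
     parcs = {(p, q). p \<in> nodes t \<and> q \<in> nodes t \<and> (\<exists>i. q = p @ [i] \<or> p = q @ [i])}\<rparr>"

definition leaf_node :: "'v set rtree \<Rightarrow> bool" where
  "leaf_node t \<longleftrightarrow> children t = []"

definition introduce_node :: "'v set rtree \<Rightarrow> bool" where
  "introduce_node t \<longleftrightarrow>
     (\<exists>s v. children t = [s] \<and> v \<notin> label s \<and> label t = insert v (label s))"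

definition forget_node :: "'v set rtree \<Rightarrow> bool" where
  "forget_node t \<longleftrightarrow>
     (\<exists>s v. children t = [s] \<and> v \<in> label s \<and> label t = label s - {v})"

definition join_node :: "'v set rtree \<Rightarrow> bool" where
  "join_node t \<longleftrightarrow>
     (\<exists>s1 s2. children t = [s1, s2] \<and> label t = label s1 \<and> label t = label s2)"

definition nice_tree_decomposition :: "'v pair_pre_digraph \<Rightarrow> 'v set rtree \<Rightarrow> bool" where
  "nice_tree_decomposition G t \<longleftrightarrow>
     tree_decomposition G (tree_graph t) (node_label t) \<and>
     label t = {} \<and>
     (\<forall>p\<in>nodes t. let s = subtree p t in
        (leaf_node s \<longrightarrow> label s = {}) \<and>
        (\<not> leaf_node s \<and> p \<noteq> [] \<longrightarrow> introduce_node s \<or> forget_node s \<or> join_node s))"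


section \<open>Oracle programs and their running time\<close>

text \<open>
  The machine model is a first-order functional language over binary trees in the style of the
  language F of N. D. Jones, ``Computability and Complexity from a Programming Perspective'', with
  several functions and arguments and an oracle expression. Without the oracle, its
  polynomial-time computable functions are those of Turing machines.

  Every evaluated expression costs one time unit. All operations act on the root of a tree only,
  so values can be shared as pointers. The tree denoted by such a pointer may be exponentially
  larger than the time spent building it, so an oracle call is additionally charged the size of
  the query and of the answer; \<^term>\<open>size\<close> of a tree is its number of \<open>Cell\<close>s.
\<close>

datatype data = Atom | Cell data data

datatype expr =
    Var nat
  | Quote data
  | MkCell expr expr
  | Fst expr
  | Snd expr
  | If expr expr expr
  | Call nat "expr list"
  | Oracle expr

text \<open>
  A program is the list of the bodies of its functions. In the body of a function, \<open>Var i\<close> is its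
  \<open>i\<close>-th argument. Function \<open>0\<close> is the entry point.
\<close>

type_synonym program = "expr list"

primrec data_fst :: "data \<Rightarrow> data" where
  "data_fst Atom = Atom"
| "data_fst (Cell x y) = x"

primrec data_snd :: "data \<Rightarrow> data" where
  "data_snd Atom = Atom"
| "data_snd (Cell x y) = y"

text \<open>
  \<open>eval P orc env e v k qs\<close>: under the environment \<open>env\<close>, expression \<open>e\<close> evaluates to \<open>v\<close> in
  time \<open>k\<close>, and \<open>qs\<close> are the oracle queries made meanwhile, in order. Nonterminating
  computations, and those using an undefined variable or function, have no derivation.
\<close>

inductive eval ::
    "program \<Rightarrow> (data \<Rightarrow> data) \<Rightarrow> data list \<Rightarrow> expr \<Rightarrow> data \<Rightarrow> nat \<Rightarrow> data list \<Rightarrow> bool"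
  and evals ::
    "program \<Rightarrow> (data \<Rightarrow> data) \<Rightarrow> data list \<Rightarrow> expr list \<Rightarrow> data list \<Rightarrow> nat \<Rightarrow> data list \<Rightarrow> bool"
  for P :: program and orc :: "data \<Rightarrow> data"
where
  Var: "i < length env \<Longrightarrow> eval P orc env (Var i) (env ! i) 1 []"
| Quote: "eval P orc env (Quote d) d 1 []"
| MkCell: "eval P orc env e1 v1 k1 qs1 \<Longrightarrow> eval P orc env e2 v2 k2 qs2 \<Longrightarrow>
    eval P orc env (MkCell e1 e2) (Cell v1 v2) (k1 + k2 + 1) (qs1 @ qs2)"
| Fst: "eval P orc env e v k qs \<Longrightarrow> eval P orc env (Fst e) (data_fst v) (k + 1) qs"
| Snd: "eval P orc env e v k qs \<Longrightarrow> eval P orc env (Snd e) (data_snd v) (k + 1) qs"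
| If_true: "eval P orc env b u k1 qs1 \<Longrightarrow> u \<noteq> Atom \<Longrightarrow> eval P orc env e1 v k2 qs2 \<Longrightarrow>
    eval P orc env (If b e1 e2) v (k1 + k2 + 1) (qs1 @ qs2)"
| If_false: "eval P orc env b Atom k1 qs1 \<Longrightarrow> eval P orc env e2 v k2 qs2 \<Longrightarrow>
    eval P orc env (If b e1 e2) v (k1 + k2 + 1) (qs1 @ qs2)"
| Call: "evals P orc env es vs k1 qs1 \<Longrightarrow> f < length P \<Longrightarrow> eval P orc vs (P ! f) v k2 qs2 \<Longrightarrow>
    eval P orc env (Call f es) v (k1 + k2 + 1) (qs1 @ qs2)"
| Oracle: "eval P orc env e q k qs \<Longrightarrow>
    eval P orc env (Oracle e) (orc q) (k + 1 + size q + size (orc q)) (qs @ [q])"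
| evals_Nil: "evals P orc env [] [] 0 []"
| evals_Cons: "eval P orc env e v k1 qs1 \<Longrightarrow> evals P orc env es vs k2 qs2 \<Longrightarrow>
    evals P orc env (e # es) (v # vs) (k1 + k2) (qs1 @ qs2)"

inductive_cases eval_VarE: "eval P orc env (Var i) v k qs"
inductive_cases eval_QuoteE: "eval P orc env (Quote d) v k qs"
inductive_cases eval_MkCellE: "eval P orc env (MkCell e1 e2) v k qs"
inductive_cases eval_FstE: "eval P orc env (Fst e) v k qs"
inductive_cases eval_SndE: "eval P orc env (Snd e) v k qs"
inductive_cases eval_IfE: "eval P orc env (If b e1 e2) v k qs"
inductive_cases eval_CallE: "eval P orc env (Call f es) v k qs"
inductive_cases eval_OracleE: "eval P orc env (Oracle e) v k qs"
inductive_cases evals_NilE: "evals P orc env [] vs k qs"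
inductive_cases evals_ConsE: "evals P orc env (e # es) vs k qs"

lemma eval_deterministic:
  "eval P orc env e v k qs \<Longrightarrow> eval P orc env e v' k' qs' \<Longrightarrow> v' = v \<and> k' = k \<and> qs' = qs"
  "evals P orc env es vs k qs \<Longrightarrow> evals P orc env es vs' k' qs' \<Longrightarrow> vs' = vs \<and> k' = k \<and> qs' = qs"
proof (induction arbitrary: v' k' qs' and vs' k' qs' rule: eval_evals.inducts)
  case (MkCell env e1 v1 k1 qs1 e2 v2 k2 qs2)
  from MkCell.prems show ?case by (rule eval_MkCellE) (auto dest!: MkCell.IH(2,4))
next
  case (If_true env b u k1 qs1 e1 v k2 qs2 e2)
  from If_true.prems show ?case by (rule eval_IfE) (use If_true.hyps in \<open>auto dest!: If_true.IH(2,4)\<close>)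
next
  case (If_false env b k1 qs1 e2 v k2 qs2 e1)
  from If_false.prems show ?case by (rule eval_IfE) (auto dest!: If_false.IH(2,4))
next
  case (Call env es vs k1 qs1 f v k2 qs2)
  from Call.prems show ?case by (rule eval_CallE) (auto dest!: Call.IH(2,5))
next
  case (evals_Cons env e v k1 qs1 es vs k2 qs2)
  from evals_Cons.prems show ?case by (rule evals_ConsE) (auto dest!: evals_Cons.IH(2,4))
next
  case (Fst env e v k qs)
  from Fst.prems show ?case by (rule eval_FstE) (auto dest!: Fst.IH(2))
next
  case (Snd env e v k qs)
  from Snd.prems show ?case by (rule eval_SndE) (auto dest!: Snd.IH(2))
next
  case (Oracle env e q k qs)
  from Oracle.prems show ?case by (rule eval_OracleE) (auto dest!: Oracle.IH(2))
qed (auto elim: eval_VarE eval_QuoteE evals_NilE)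

definition run :: "program \<Rightarrow> (data \<Rightarrow> data) \<Rightarrow> data \<Rightarrow> data \<Rightarrow> nat \<Rightarrow> data list \<Rightarrow> bool" where
  "run P orc x y k qs \<longleftrightarrow> P \<noteq> [] \<and> eval P orc [x] (P ! 0) y k qs"


section \<open>Encodings\<close>

text \<open>
  Vertices are natural numbers, encoded in binary with the least significant bit first. A finite
  set is encoded by any duplicate-free list of its elements, so it has several encodings.
\<close>

fun enc_nat :: "nat \<Rightarrow> data" where
  "enc_nat n = (if n = 0 then Atom
     else Cell (if odd n then Cell Atom Atom else Atom) (enc_nat (n div 2)))"

declare enc_nat.simps [simp del]

definition enc_list :: "data list \<Rightarrow> data" where
  "enc_list ds = foldr Cell ds Atom"

definition enc_arc :: "nat \<times> nat \<Rightarrow> data" where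
  "enc_arc a = Cell (enc_nat (fst a)) (enc_nat (snd a))"

primrec enc_rtree :: "('a \<Rightarrow> data) \<Rightarrow> 'a rtree \<Rightarrow> data" where
  "enc_rtree enc (Node a ts) = Cell (enc a) (enc_list (map (enc_rtree enc) ts))"

definition encodes_set :: "('a \<Rightarrow> data) \<Rightarrow> data \<Rightarrow> 'a set \<Rightarrow> bool" where
  "encodes_set enc d X \<longleftrightarrow> (\<exists>xs. distinct xs \<and> set xs = X \<and> d = enc_list (map enc xs))"

definition encodes_graph :: "data \<Rightarrow> nat pair_pre_digraph \<Rightarrow> bool" where
  "encodes_graph d G \<longleftrightarrow> (\<exists>dv da. d = Cell dv da \<and>
     encodes_set enc_nat dv (pverts G) \<and> encodes_set enc_arc da (parcs G))"

definition encodes_bag_tree :: "data \<Rightarrow> nat set rtree \<Rightarrow> bool" where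
  "encodes_bag_tree d t \<longleftrightarrow> (\<exists>t' :: nat list rtree. map_rtree set t' = t \<and>
     (\<forall>xs\<in>set_rtree t'. distinct xs) \<and> d = enc_rtree (\<lambda>xs. enc_list (map enc_nat xs)) t')"

definition encodes_input :: "data \<Rightarrow> nat pair_pre_digraph \<Rightarrow> nat set rtree \<Rightarrow> bool" where
  "encodes_input d G t \<longleftrightarrow> (\<exists>dg dt. d = Cell dg dt \<and> encodes_graph dg G \<and> encodes_bag_tree dt t)"


section \<open>Approximate Turing kernelizations for Dominating Set\<close>

definition approx_solution :: "real \<Rightarrow> nat pair_pre_digraph \<Rightarrow> data \<Rightarrow> bool" where
  "approx_solution r G d \<longleftrightarrow> (\<exists>X. encodes_set enc_nat d X \<and> dominating_set G X \<and>
     real (card X) \<le> r * real (domination_number G))"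

definition bounded_query :: "real \<Rightarrow> data \<Rightarrow> nat pair_pre_digraph \<Rightarrow> bool" where
  "bounded_query b q H \<longleftrightarrow> pair_graph H \<and> encodes_graph q H \<and> real (card (pverts H)) \<le> b"

text \<open>Nothing is assumed about the answers to queries that are too large or malformed.\<close>

definition approx_oracle :: "real \<Rightarrow> real \<Rightarrow> (data \<Rightarrow> data) \<Rightarrow> bool" where
  "approx_oracle c b orc \<longleftrightarrow> (\<forall>q H. bounded_query b q H \<longrightarrow> approx_solution c H (orc q))"

text \<open>
  \<open>bound\<close> maps treewidth and maximum degree of the input graph to the permitted number of
  vertices of a query. The program and the polynomial are fixed before \<open>c\<close> is chosen.
\<close>

definition approx_turing_kernelization ::
    "real \<Rightarrow> (nat \<Rightarrow> nat \<Rightarrow> real) \<Rightarrow> program \<Rightarrow> bool" where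
  "approx_turing_kernelization \<alpha> bound P \<longleftrightarrow>
     (\<exists>p :: nat poly. \<forall>G t x.
        pair_graph G \<and> nice_tree_decomposition G t \<and>
        decomposition_width (tree_graph t) (node_label t) = treewidth G \<and>
        encodes_input x G t \<longrightarrow>
        (let b = bound (treewidth G) (max_degree G) in
         \<forall>(c :: real) orc. c \<ge> 1 \<and> approx_oracle c b orc \<longrightarrow>
           (\<exists>y k qs. run P orc x y k qs \<and>
              k \<le> poly p (size x) \<and>
              (\<forall>q\<in>set qs. \<exists>H. bounded_query b q H) \<and>
              approx_solution (c * \<alpha>) G y)))"

end

theory Submission
  imports Defs
begin

text \<open>
  Let \<open>w\<close> be the largest bag size, \<open>\<Delta>\<close> the maximum degree and \<open>M = K * w * (\<Delta> + 1)\<close>. The program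
  works through the tree decomposition bottom-up and collects the vertices of the processed bags in
  a set \<open>U\<close> of pending vertices. Whenever \<open>U\<close> reaches size \<open>M\<close>, it asks the oracle for a dominating
  set of \<open>G[U]\<close>, adds it to the solution, and keeps only the current bag pending. Each merge at
  most doubles the pending set, so the queries have at most \<open>2 * M\<close> vertices.

  Call a vertex of a query interior if it lies neither in the bag of this cut nor in that of an
  earlier one. The neighbours of an interior vertex all belong to the query, so a minimum dominating
  set \<open>D\<close> of \<open>G\<close> shows that the query has a solution with at most one vertex for each interior
  vertex in \<open>D\<close> and for each boundary vertex. No vertex is interior to two queries, and \<open>q\<close> cuts
  create at most \<open>2 * w * q\<close> boundary vertices. As they also use up \<open>q * M\<close> vertices and
  \<open>G\<close> has at most \<open>(\<Delta> + 1) * card D\<close> vertices, the boundary vertices number at most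
  \<open>2 / (K - 2) * card D\<close>, which is at most \<open>\<epsilon> * card D\<close> for \<open>K \<ge> 2 + 2 / \<epsilon>\<close>.
\<close>

section \<open>The program\<close>

definition true :: data where
  "true = Cell Atom Atom"

definition truth :: "bool \<Rightarrow> data" where
  "truth b = (if b then true else Atom)"

text \<open>Numbers are handled as lengths of lists, so that a threshold can be compared with a
  vertex list directly and products arise by repetition.\<close>

fun unary :: "nat \<Rightarrow> data" where
  "unary 0 = Atom"
| "unary (Suc n) = Cell Atom (unary n)"

abbreviation (input) "call_eq a b \<equiv> Call 1 [a, b]"
abbreviation (input) "call_mem a l \<equiv> Call 2 [a, l]"
abbreviation (input) "call_union a b \<equiv> Call 3 [a, b]"
abbreviation (input) "call_induced as u \<equiv> Call 4 [as, u]"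
abbreviation (input) "call_longer_eq a b \<equiv> Call 5 [a, b]"
abbreviation (input) "call_longer a b \<equiv> Call 6 [a, b]"
abbreviation (input) "call_max_bag f \<equiv> Call 7 [f]"
abbreviation (input) "call_degree v as \<equiv> Call 8 [v, as]"
abbreviation (input) "call_max_degree vs as \<equiv> Call 9 [vs, as]"
abbreviation (input) "call_append a b \<equiv> Call 10 [a, b]"
abbreviation (input) "call_repeat a b \<equiv> Call 11 [a, b]"
abbreviation (input) "call_cut as m b u s \<equiv> Call 12 [as, m, b, u, s]"
abbreviation (input) "call_merge as m b r r' \<equiv> Call 13 [as, m, b, r, r']"
abbreviation (input) "call_forest as m b f \<equiv> Call 14 [as, m, b, f]"
abbreviation (input) "call_finish as r \<equiv> Call 15 [as, r]"

text \<open>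
  A forest is encoded as the list of its trees, so a nonempty forest has the form
  \<open>Cell (Cell bag children) rest\<close>. The constant \<open>K\<close> is the only part that depends on \<open>\<epsilon>\<close>.
\<close>

definition kernel_program :: "nat \<Rightarrow> program" where
  "kernel_program K =
    [\<comment> \<open>0: main\<close>
     If (Snd (Fst (Var 0)))
       (call_finish (Snd (Fst (Var 0)))
         (call_forest (Snd (Fst (Var 0)))
           (call_repeat (Quote (unary K))
             (call_repeat (call_max_bag (MkCell (Snd (Var 0)) (Quote Atom)))
               (MkCell (Quote Atom) (call_max_degree (Fst (Fst (Var 0))) (Snd (Fst (Var 0)))))))
           (Quote Atom)
           (MkCell (Snd (Var 0)) (Quote Atom))))
       (Fst (Fst (Var 0))),
     \<comment> \<open>1: eq\<close>
     If (Var 0)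
       (If (Var 1)
         (If (call_eq (Fst (Var 0)) (Fst (Var 1))) (call_eq (Snd (Var 0)) (Snd (Var 1))) (Quote Atom))
         (Quote Atom))
       (If (Var 1) (Quote Atom) (Quote true)),
     \<comment> \<open>2: mem\<close>
     If (Var 1)
       (If (call_eq (Var 0) (Fst (Var 1))) (Quote true) (call_mem (Var 0) (Snd (Var 1))))
       (Quote Atom),
     \<comment> \<open>3: union\<close>
     If (Var 0)
       (If (call_mem (Fst (Var 0)) (Var 1))
         (call_union (Snd (Var 0)) (Var 1))
         (MkCell (Fst (Var 0)) (call_union (Snd (Var 0)) (Var 1))))
       (Var 1),
     \<comment> \<open>4: induced\<close>
     If (Var 0)
       (If (call_mem (Fst (Fst (Var 0))) (Var 1))
         (If (call_mem (Snd (Fst (Var 0))) (Var 1))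
           (MkCell (Fst (Var 0)) (call_induced (Snd (Var 0)) (Var 1)))
           (call_induced (Snd (Var 0)) (Var 1)))
         (call_induced (Snd (Var 0)) (Var 1)))
       (Quote Atom),
     \<comment> \<open>5: longer_eq\<close>
     If (Var 1)
       (If (Var 0) (call_longer_eq (Snd (Var 0)) (Snd (Var 1))) (Quote Atom))
       (Quote true),
     \<comment> \<open>6: longer\<close>
     If (call_longer_eq (Var 0) (Var 1)) (Var 0) (Var 1),
     \<comment> \<open>7: max_bag\<close>
     If (Var 0)
       (call_longer (Fst (Fst (Var 0)))
         (call_longer (call_max_bag (Snd (Fst (Var 0)))) (call_max_bag (Snd (Var 0)))))
       (Quote Atom),
     \<comment> \<open>8: degree\<close>
     If (Var 1)
       (If (call_eq (Var 0) (Fst (Fst (Var 1))))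
         (MkCell (Quote Atom) (call_degree (Var 0) (Snd (Var 1))))
         (call_degree (Var 0) (Snd (Var 1))))
       (Quote Atom),
     \<comment> \<open>9: max_degree\<close>
     If (Var 0)
       (call_longer (call_degree (Fst (Var 0)) (Var 1)) (call_max_degree (Snd (Var 0)) (Var 1)))
       (Quote Atom),
     \<comment> \<open>10: append\<close>
     If (Var 0) (MkCell (Fst (Var 0)) (call_append (Snd (Var 0)) (Var 1))) (Var 1),
     \<comment> \<open>11: repeat\<close>
     If (Var 0) (call_append (Var 1) (call_repeat (Snd (Var 0)) (Var 1))) (Quote Atom),
     \<comment> \<open>12: cut (arcs, threshold, bag, pending vertices, solution)\<close>
     If (call_longer_eq (Var 3) (Var 1))
       (MkCell (Var 2)
         (call_union (Oracle (MkCell (Var 3) (call_induced (Var 0) (Var 3)))) (Var 4)))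
       (MkCell (Var 3) (Var 4)),
     \<comment> \<open>13: merge (arcs, threshold, bag, result of a child, result of its later siblings)\<close>
     call_cut (Var 0) (Var 1) (Var 2)
       (call_union (Fst (Var 3)) (Fst (Var 4))) (call_union (Snd (Var 3)) (Snd (Var 4))),
     \<comment> \<open>14: forest (arcs, threshold, bag, forest below it)\<close>
     If (Var 3)
       (call_merge (Var 0) (Var 1) (Var 2)
         (call_forest (Var 0) (Var 1) (Fst (Fst (Var 3))) (Snd (Fst (Var 3))))
         (call_forest (Var 0) (Var 1) (Var 2) (Snd (Var 3))))
       (MkCell (Var 2) (Quote Atom)),
     \<comment> \<open>15: finish (arcs, result)\<close>
     call_union (Oracle (MkCell (Fst (Var 1)) (call_induced (Var 0) (Fst (Var 1))))) (Snd (Var 1))]"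

section \<open>Functional counterparts of the program's functions\<close>

fun mem :: "data \<Rightarrow> data \<Rightarrow> bool" where
  "mem x Atom = False"
| "mem x (Cell y l) = (x = y \<or> mem x l)"

fun union_list :: "data \<Rightarrow> data \<Rightarrow> data" where
  "union_list Atom l = l"
| "union_list (Cell x k) l = (if mem x l then union_list k l else Cell x (union_list k l))"

fun induced_arcs :: "data \<Rightarrow> data \<Rightarrow> data" where
  "induced_arcs Atom u = Atom"
| "induced_arcs (Cell a as) u = (if mem (data_fst a) u \<and> mem (data_snd a) u
     then Cell a (induced_arcs as u) else induced_arcs as u)"

fun len :: "data \<Rightarrow> nat" where
  "len Atom = 0"
| "len (Cell x l) = Suc (len l)"

definition longer :: "data \<Rightarrow> data \<Rightarrow> data" where
  "longer k l = (if len l \<le> len k then k else l)"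

lemma size_data_fst [termination_simp]: "size (data_fst d) \<le> size d"
  by (cases d) auto

text \<open>Lets the termination prover accept recursion into \<open>data_snd t\<close>, that is,
  into the children of the first tree of a forest.\<close>

lemma size_data_snd [termination_simp]: "size (data_snd d) \<le> size d"
  by (cases d) auto

text \<open>The argument is an encoded forest. A longest bag itself is returned, since its length
  already serves as the number.\<close>

fun max_bag :: "data \<Rightarrow> data" where
  "max_bag Atom = Atom"
| "max_bag (Cell t ts) = longer (data_fst t) (longer (max_bag (data_snd t)) (max_bag ts))"

fun degree_in :: "data \<Rightarrow> data \<Rightarrow> data" where
  "degree_in v Atom = Atom"
| "degree_in v (Cell a as) =
     (if v = data_fst a then Cell Atom (degree_in v as) else degree_in v as)"

fun max_degree_in :: "data \<Rightarrow> data \<Rightarrow> data" where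
  "max_degree_in Atom as = Atom"
| "max_degree_in (Cell v vs) as = longer (degree_in v as) (max_degree_in vs as)"

fun append_list :: "data \<Rightarrow> data \<Rightarrow> data" where
  "append_list Atom l = l"
| "append_list (Cell x k) l = Cell x (append_list k l)"

fun repeat_list :: "data \<Rightarrow> data \<Rightarrow> data" where
  "repeat_list Atom l = Atom"
| "repeat_list (Cell x k) l = append_list l (repeat_list k l)"

abbreviation query :: "data \<Rightarrow> data \<Rightarrow> data" where
  "query as u \<equiv> Cell u (induced_arcs as u)"

text \<open>A list of length \<open>K * w * (\<Delta> + 1)\<close>; the \<open>Cell\<close> in front
  of the maximum degree supplies the \<open>+ 1\<close>.\<close>

definition threshold :: "nat \<Rightarrow> data \<Rightarrow> data \<Rightarrow> data" where
  "threshold K g f = repeat_list (unary K)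
     (repeat_list (max_bag f) (Cell Atom (max_degree_in (data_fst g) (data_snd g))))"

lemma truth_eq_Atom [simp]: "truth b = Atom \<longleftrightarrow> \<not> b"
  by (simp add: truth_def true_def)

section \<open>Sizes of the computed lists\<close>

lemma size_longer: "size (longer k l) \<le> size k + size l"
  by (simp add: longer_def)

lemma size_max_bag: "size (max_bag f) \<le> size f"
proof (induction f rule: max_bag.induct)
  case (2 t ts)
  have "size (data_fst t) + size (data_snd t) \<le> size t" by (cases t) auto
  with 2 show ?case
    using size_longer[of "data_fst t" "longer (max_bag (data_snd t)) (max_bag ts)"]
      size_longer[of "max_bag (data_snd t)" "max_bag ts"]
    by simp
qed simp

lemma size_degree_in: "size (degree_in v as) \<le> size as"
  by (induction as) auto

lemma size_induced_arcs: "size (induced_arcs as u) \<le> size as"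
  by (induction as) auto

lemma size_append_list: "size (append_list k l) = size k + size l"
  by (induction k) auto

lemma size_repeat_list: "size (repeat_list k l) = len k * size l"
  by (induction k) (auto simp: size_append_list)

lemma len_le_size: "len d \<le> size d"
  by (induction d) auto

lemma size_unary: "size (unary n) = n" and len_unary: "len (unary n) = n"
  by (induction n) auto

lemma size_max_degree_in: "size (max_degree_in vs as) \<le> size as"
proof (induction vs)
  case (Cell v vs)
  then show ?case using size_degree_in[of v as] by (simp add: longer_def)
qed simp

section \<open>Symbolic execution with time bounds\<close>

text \<open>\<open>Q\<close> is the set of permitted queries. As a parameter, it lets time and
  queries be controlled by the same predicate.\<close>

locale kernel_run =
  fixes K :: nat and orc :: "data \<Rightarrow> data" and Q :: "data set" and N :: nat
begin

definition cut :: "data \<Rightarrow> data \<Rightarrow> data \<Rightarrow> data \<Rightarrow> data \<Rightarrow> data" where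
  "cut as m b u s = (if len m \<le> len u then Cell b (union_list (orc (query as u)) s) else Cell u s)"

definition merge :: "data \<Rightarrow> data \<Rightarrow> data \<Rightarrow> data \<Rightarrow> data \<Rightarrow> data" where
  "merge as m b r r' = cut as m b (union_list (data_fst r) (data_fst r'))
     (union_list (data_snd r) (data_snd r'))"

fun process :: "data \<Rightarrow> data \<Rightarrow> data \<Rightarrow> data \<Rightarrow> data" where
  "process as m b Atom = Cell b Atom"
| "process as m b (Cell t ts) =
     merge as m b (process as m (data_fst t) (data_snd t)) (process as m b ts)"

definition finish :: "data \<Rightarrow> data \<Rightarrow> data" where
  "finish as r = union_list (orc (query as (data_fst r))) (data_snd r)"

definition main :: "data \<Rightarrow> data" where
  "main x = (let g = data_fst x; as = data_snd g; f = Cell (data_snd x) Atom in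
     if as \<noteq> Atom then finish as (process as (threshold K g f) Atom f) else data_fst g)"

definition fun_value :: "nat \<Rightarrow> data list \<Rightarrow> data" where
  "fun_value f = [
     \<lambda>vs. main (vs ! 0),
     \<lambda>vs. truth (vs ! 0 = vs ! 1),
     \<lambda>vs. truth (mem (vs ! 0) (vs ! 1)),
     \<lambda>vs. union_list (vs ! 0) (vs ! 1),
     \<lambda>vs. induced_arcs (vs ! 0) (vs ! 1),
     \<lambda>vs. truth (len (vs ! 1) \<le> len (vs ! 0)),
     \<lambda>vs. longer (vs ! 0) (vs ! 1),
     \<lambda>vs. max_bag (vs ! 0),
     \<lambda>vs. degree_in (vs ! 0) (vs ! 1),
     \<lambda>vs. max_degree_in (vs ! 0) (vs ! 1),
     \<lambda>vs. append_list (vs ! 0) (vs ! 1),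
     \<lambda>vs. repeat_list (vs ! 0) (vs ! 1),
     \<lambda>vs. cut (vs ! 0) (vs ! 1) (vs ! 2) (vs ! 3) (vs ! 4),
     \<lambda>vs. merge (vs ! 0) (vs ! 1) (vs ! 2) (vs ! 3) (vs ! 4),
     \<lambda>vs. process (vs ! 0) (vs ! 1) (vs ! 2) (vs ! 3),
     \<lambda>vs. finish (vs ! 0) (vs ! 1)] ! f"

text \<open>The constants here and below are generous, as only a polynomial bound is wanted.\<close>

definition union_time :: "data \<Rightarrow> data \<Rightarrow> nat" where
  "union_time k l = (size k + 1) * (20 * size l + 30)"

definition query_time :: "data \<Rightarrow> data \<Rightarrow> nat" where
  "query_time as u = (size as + 1) * (40 * size u + 50) + size (query as u) + size (orc (query as u))"

definition cut_time :: "data \<Rightarrow> data \<Rightarrow> data \<Rightarrow> nat" where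
  "cut_time as u s = 10 * size u + query_time as u + union_time (orc (query as u)) s + 50"

definition merge_time :: "data \<Rightarrow> data \<Rightarrow> data \<Rightarrow> nat" where
  "merge_time as r r' =
    (let u = union_list (data_fst r) (data_fst r'); s = union_list (data_snd r) (data_snd r')
     in union_time (data_fst r) (data_fst r') + union_time (data_snd r) (data_snd r') +
        cut_time as u s + 50)"

text \<open>
  The entry of \<open>main\<close> is a dummy, as \<open>main\<close> is never called. Each step of \<open>process\<close> is charged the
  parameter \<open>N\<close>, which stands for a bound on \<open>merge_time\<close>.
\<close>

definition fun_time :: "nat \<Rightarrow> data list \<Rightarrow> nat" where
  "fun_time f = [
     \<lambda>vs. 0,
     \<lambda>vs. 20 * size (vs ! 1) + 5,
     \<lambda>vs. 20 * size (vs ! 1) + 5,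
     \<lambda>vs. union_time (vs ! 0) (vs ! 1),
     \<lambda>vs. (size (vs ! 0) + 1) * (40 * size (vs ! 1) + 50),
     \<lambda>vs. 10 * size (vs ! 0) + 10,
     \<lambda>vs. 10 * size (vs ! 0) + 20,
     \<lambda>vs. (2 * size (vs ! 0) + 1) * (20 * size (vs ! 0) + 70),
     \<lambda>vs. 30 * size (vs ! 1) + 5,
     \<lambda>vs. (size (vs ! 0) + 1) * (40 * size (vs ! 1) + 60),
     \<lambda>vs. 10 * size (vs ! 0) + 10,
     \<lambda>vs. (size (vs ! 0) + 1) * (10 * size (vs ! 1) + 30),
     \<lambda>vs. cut_time (vs ! 0) (vs ! 3) (vs ! 4),
     \<lambda>vs. merge_time (vs ! 0) (vs ! 3) (vs ! 4),
     \<lambda>vs. (2 * size (vs ! 3) + 1) * N,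
     \<lambda>vs. query_time (vs ! 0) (data_fst (vs ! 1)) +
        union_time (orc (query (vs ! 0) (data_fst (vs ! 1)))) (data_snd (vs ! 1)) + 50] ! f"

definition computes :: "data list \<Rightarrow> expr \<Rightarrow> data \<Rightarrow> nat \<Rightarrow> bool" where
  "computes env e v T \<longleftrightarrow>
     (\<exists>k qs. eval (kernel_program K) orc env e v k qs \<and> k \<le> T \<and> set qs \<subseteq> Q)"

text \<open>This speaks of concrete arguments \<open>vs\<close>, so that a recursive function can be
  verified by induction on its argument, the induction hypothesis providing the recursive
  calls.\<close>

definition callable :: "nat \<Rightarrow> data list \<Rightarrow> bool" where
  "callable f vs \<longleftrightarrow> f < length (kernel_program K) \<and>
     computes vs (kernel_program K ! f) (fun_value f vs) (fun_time f vs)"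

text \<open>
  \<open>expr_value\<close>, \<open>expr_time\<close> and \<open>expr_ok\<close> execute an expression symbolically, taking the value and a
  time bound of each called function from \<open>fun_value\<close> and \<open>fun_time\<close>. A concrete function body is
  thus verified by simplification.
\<close>

primrec expr_value :: "data list \<Rightarrow> expr \<Rightarrow> data" where
  "expr_value env (Var i) = env ! i"
| "expr_value env (Quote d) = d"
| "expr_value env (MkCell e1 e2) = Cell (expr_value env e1) (expr_value env e2)"
| "expr_value env (Fst e) = data_fst (expr_value env e)"
| "expr_value env (Snd e) = data_snd (expr_value env e)"
| "expr_value env (If b e1 e2) =
     (if expr_value env b \<noteq> Atom then expr_value env e1 else expr_value env e2)"
| "expr_value env (Call f es) = fun_value f (map (expr_value env) es)"
| "expr_value env (Oracle e) = orc (expr_value env e)"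

primrec expr_time :: "data list \<Rightarrow> expr \<Rightarrow> nat" where
  "expr_time env (Var i) = 1"
| "expr_time env (Quote d) = 1"
| "expr_time env (MkCell e1 e2) = expr_time env e1 + expr_time env e2 + 1"
| "expr_time env (Fst e) = expr_time env e + 1"
| "expr_time env (Snd e) = expr_time env e + 1"
| "expr_time env (If b e1 e2) = expr_time env b +
     (if expr_value env b \<noteq> Atom then expr_time env e1 else expr_time env e2) + 1"
| "expr_time env (Call f es) =
     sum_list (map (expr_time env) es) + fun_time f (map (expr_value env) es) + 1"
| "expr_time env (Oracle e) =
     expr_time env e + 1 + size (expr_value env e) + size (orc (expr_value env e))"

primrec expr_ok :: "data list \<Rightarrow> expr \<Rightarrow> bool" where
  "expr_ok env (Var i) \<longleftrightarrow> i < length env"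
| "expr_ok env (Quote d) \<longleftrightarrow> True"
| "expr_ok env (MkCell e1 e2) \<longleftrightarrow> expr_ok env e1 \<and> expr_ok env e2"
| "expr_ok env (Fst e) \<longleftrightarrow> expr_ok env e"
| "expr_ok env (Snd e) \<longleftrightarrow> expr_ok env e"
| "expr_ok env (If b e1 e2) \<longleftrightarrow> expr_ok env b \<and>
     (if expr_value env b \<noteq> Atom then expr_ok env e1 else expr_ok env e2)"
| "expr_ok env (Call f es) \<longleftrightarrow>
     list_all (\<lambda>b. b) (map (expr_ok env) es) \<and> callable f (map (expr_value env) es)"
| "expr_ok env (Oracle e) \<longleftrightarrow> expr_ok env e \<and> expr_value env e \<in> Q"

lemma evals_args:
  assumes "\<And>e. e \<in> set es \<Longrightarrow> computes env e (expr_value env e) (expr_time env e)"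
  shows "\<exists>k qs. evals (kernel_program K) orc env es (map (expr_value env) es) k qs \<and>
     k \<le> sum_list (map (expr_time env) es) \<and> set qs \<subseteq> Q"
  using assms
proof (induction es)
  case Nil
  show ?case by (auto intro: evals_Nil)
next
  case (Cons e es)
  from Cons.prems obtain k1 qs1 where 1: "eval (kernel_program K) orc env e (expr_value env e) k1 qs1"
    "k1 \<le> expr_time env e" "set qs1 \<subseteq> Q"
    unfolding computes_def by fastforce
  from Cons obtain k2 qs2 where 2:
    "evals (kernel_program K) orc env es (map (expr_value env) es) k2 qs2"
    "k2 \<le> sum_list (map (expr_time env) es)" "set qs2 \<subseteq> Q"
    by fastforce
  from evals_Cons[OF 1(1) 2(1)] 1(2,3) 2(2,3) show ?case
    by (intro exI[of _ "k1 + k2"] exI[of _ "qs1 @ qs2"]) auto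
qed

text \<open>Soundness of the symbolic execution. Calls are opaque because \<open>expr_ok\<close>
  already demands \<open>callable\<close>, so induction on the expression suffices and the recursion
  of the program does not enter.\<close>

lemma computes_expr:
  "expr_ok env e \<Longrightarrow> computes env e (expr_value env e) (expr_time env e)"
proof (induction e)
  case (Var i)
  then show ?case
    unfolding computes_def by (auto intro!: exI eval_evals.Var)
next
  case (Quote d)
  then show ?case unfolding computes_def by (auto intro!: exI eval_evals.Quote)
next
  case (MkCell e1 e2)
  from MkCell obtain k1 qs1 k2 qs2 where 1:
    "eval (kernel_program K) orc env e1 (expr_value env e1) k1 qs1" "k1 \<le> expr_time env e1" "set qs1 \<subseteq> Q"
    and 2: "eval (kernel_program K) orc env e2 (expr_value env e2) k2 qs2" "k2 \<le> expr_time env e2" "set qs2 \<subseteq> Q"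
    unfolding computes_def by auto
  from eval_evals.MkCell[OF 1(1) 2(1)] 1(2,3) 2(2,3) show ?case
    unfolding computes_def by (intro exI[of _ "k1 + k2 + 1"] exI[of _ "qs1 @ qs2"]) auto
next
  case (Fst e)
  then obtain k qs where 1:
    "eval (kernel_program K) orc env e (expr_value env e) k qs" "k \<le> expr_time env e" "set qs \<subseteq> Q"
    unfolding computes_def by auto
  from eval_evals.Fst[OF 1(1)] 1(2,3) show ?case
    unfolding computes_def by (intro exI[of _ "k + 1"] exI[of _ qs]) auto
next
  case (Snd e)
  then obtain k qs where 1:
    "eval (kernel_program K) orc env e (expr_value env e) k qs" "k \<le> expr_time env e" "set qs \<subseteq> Q"
    unfolding computes_def by auto
  from eval_evals.Snd[OF 1(1)] 1(2,3) show ?case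
    unfolding computes_def by (intro exI[of _ "k + 1"] exI[of _ qs]) auto
next
  case (If b e1 e2)
  then obtain k1 qs1 where 1:
    "eval (kernel_program K) orc env b (expr_value env b) k1 qs1" "k1 \<le> expr_time env b" "set qs1 \<subseteq> Q"
    unfolding computes_def by auto
  show ?case
  proof (cases "expr_value env b = Atom")
    case True
    with If obtain k2 qs2 where 2: "eval (kernel_program K) orc env e2 (expr_value env e2) k2 qs2"
      "k2 \<le> expr_time env e2" "set qs2 \<subseteq> Q"
      unfolding computes_def by auto
    from eval_evals.If_false[OF 1(1)[unfolded True] 2(1)] 1(2,3) 2(2,3) True show ?thesis
      unfolding computes_def by (intro exI[of _ "k1 + k2 + 1"] exI[of _ "qs1 @ qs2"]) auto
  next
    case False
    with If obtain k2 qs2 where 2: "eval (kernel_program K) orc env e1 (expr_value env e1) k2 qs2"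
      "k2 \<le> expr_time env e1" "set qs2 \<subseteq> Q"
      unfolding computes_def by auto
    from eval_evals.If_true[OF 1(1) False 2(1)] 1(2,3) 2(2,3) False show ?thesis
      unfolding computes_def by (intro exI[of _ "k1 + k2 + 1"] exI[of _ "qs1 @ qs2"]) auto
  qed
next
  case (Call f es)
  then have "\<And>e. e \<in> set es \<Longrightarrow> computes env e (expr_value env e) (expr_time env e)"
    by (auto simp: list_all_iff)
  from evals_args[OF this] obtain k1 qs1 where 1:
    "evals (kernel_program K) orc env es (map (expr_value env) es) k1 qs1"
    "k1 \<le> sum_list (map (expr_time env) es)" "set qs1 \<subseteq> Q"
    by blast
  have "callable f (map (expr_value env) es)"
    using Call.prems by simp
  then obtain k2 qs2 where 2: "f < length (kernel_program K)"
    "eval (kernel_program K) orc (map (expr_value env) es) (kernel_program K ! f)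
       (fun_value f (map (expr_value env) es)) k2 qs2"
    "k2 \<le> fun_time f (map (expr_value env) es)" "set qs2 \<subseteq> Q"
    unfolding callable_def computes_def by auto
  from eval_evals.Call[OF 1(1) 2(1,2)] 1(2,3) 2(3,4) show ?case
    unfolding computes_def by (intro exI[of _ "k1 + k2 + 1"] exI[of _ "qs1 @ qs2"]) auto
next
  case (Oracle e)
  then obtain k qs where 1:
    "eval (kernel_program K) orc env e (expr_value env e) k qs" "k \<le> expr_time env e" "set qs \<subseteq> Q"
    unfolding computes_def by auto
  from eval_evals.Oracle[OF 1(1)] 1(2,3) Oracle.prems show ?case
    unfolding computes_def
    by (intro exI[of _ "k + 1 + size (expr_value env e) + size (orc (expr_value env e))"]
        exI[of _ "qs @ [expr_value env e]"]) auto
qed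

section \<open>Verification of the individual functions\<close>

lemma callableI:
  assumes "f < length (kernel_program K)"
    and "expr_ok vs (kernel_program K ! f)"
    and "expr_value vs (kernel_program K ! f) = fun_value f vs"
    and "expr_time vs (kernel_program K ! f) \<le> fun_time f vs"
  shows "callable f vs"
proof -
  from computes_expr[OF assms(2)] assms(3,4) have "computes vs (kernel_program K ! f) (fun_value f vs) (fun_time f vs)"
    unfolding computes_def by (metis le_trans)
  with assms(1) show ?thesis unfolding callable_def by blast
qed

lemmas exec_simps = kernel_program_def fun_value_def fun_time_def

text \<open>The comparison ends when either argument is exhausted. Charging only the second one
  makes \<open>mem\<close>, which passes the list element there, linear in the list. The index is
  \<open>Suc 0\<close> because simplification rewrites \<open>1\<close> to it.\<close>

lemma callable_eq: "callable (Suc 0) [a, b]"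
proof (induction a arbitrary: b)
  case Atom
  show ?case by (rule callableI; cases b) (simp_all add: exec_simps truth_def)
next
  case (Cell a1 a2)
  show ?case
  proof (cases b)
    case Atom
    then show ?thesis by (intro callableI) (simp_all add: exec_simps truth_def)
  next
    case b: (Cell b1 b2)
    show ?thesis unfolding b
      by (rule callableI) (use Cell.IH in \<open>simp_all add: exec_simps\<close>, auto simp: truth_def)
  qed
qed

lemma callable_mem: "callable 2 [x, l]"
proof (induction l)
  case Atom
  show ?case by (rule callableI) (simp_all add: exec_simps truth_def)
next
  case (Cell y l)
  then show ?case
    by (intro callableI) (simp_all add: exec_simps callable_eq, auto simp: truth_def)
qed

lemma callable_union: "callable 3 [k, l]"
proof (induction k)
  case Atom
  show ?case by (rule callableI) (simp_all add: exec_simps union_time_def)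
next
  case (Cell x k)
  then show ?case
    by (intro callableI) (simp_all add: exec_simps callable_mem union_time_def algebra_simps)
qed

lemma callable_induced: "callable 4 [as, u]"
proof (induction as)
  case Atom
  show ?case by (rule callableI) (simp_all add: exec_simps)
next
  case (Cell a as)
  then show ?case
    by (intro callableI) (simp_all add: exec_simps callable_mem algebra_simps)
qed

lemma callable_longer_eq: "callable 5 [k, l]"
proof (induction k arbitrary: l)
  case Atom
  show ?case by (rule callableI; cases l) (simp_all add: exec_simps truth_def)
next
  case (Cell x k)
  then show ?case
    by (intro callableI; cases l) (simp_all add: exec_simps truth_def)
qed

lemma callable_longer: "callable 6 [k, l]"
  by (rule callableI) (simp_all add: exec_simps callable_longer_eq longer_def)

lemma callable_max_bag: "callable 7 [f]"
proof (induction f rule: max_bag.induct)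
  case 1
  show ?case by (rule callableI) (simp_all add: exec_simps)
next
  case (2 t ts)
  let ?X = "20 * size (Cell t ts) + 70"
  \<comment> \<open>\<open>2 * size f + 1\<close> bounds the number of calls: those for the
    children, those for the siblings, and the current one.\<close>
  have le: "(2 * size (data_snd t) + 1) + (2 * size ts + 1) + 1 \<le> 2 * size (Cell t ts) + 1"
    by (cases t) simp_all
  have "(2 * size (data_snd t) + 1) * (20 * size (data_snd t) + 70) \<le> (2 * size (data_snd t) + 1) * ?X"
    "(2 * size ts + 1) * (20 * size ts + 70) \<le> (2 * size ts + 1) * ?X"
    using size_data_snd[of t] by (intro mult_le_mono2; simp)+
  then have "(2 * size (data_snd t) + 1) * (20 * size (data_snd t) + 70) +
      (2 * size ts + 1) * (20 * size ts + 70) + ?X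
    \<le> ((2 * size (data_snd t) + 1) + (2 * size ts + 1) + 1) * ?X"
    by (simp add: algebra_simps)
  also have "\<dots> \<le> (2 * size (Cell t ts) + 1) * ?X"
    using le by (rule mult_le_mono1)
  finally have *: "(2 * size (data_snd t) + 1) * (20 * size (data_snd t) + 70) +
      (2 * size ts + 1) * (20 * size ts + 70) + ?X \<le> (2 * size (Cell t ts) + 1) * ?X" .
  \<comment> \<open>The two calls of \<open>longer\<close> are charged for their first arguments,
    \<open>data_fst t\<close> and \<open>max_bag (data_snd t)\<close>, which together fit into
    \<open>t\<close>.\<close>
  have "size (max_bag (data_snd t)) + size (data_fst t) \<le> size t"
    using size_max_bag[of "data_snd t"] by (cases t) auto
  with * 2 show ?case
    by (intro callableI) (simp_all add: exec_simps callable_longer)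
qed

lemma callable_degree: "callable 8 [v, as]"
proof (induction as)
  case Atom
  show ?case by (rule callableI) (simp_all add: exec_simps)
next
  case (Cell a as)
  with size_data_fst[of a] show ?case
    by (intro callableI) (simp_all add: exec_simps callable_eq, auto)
qed

lemma callable_max_degree: "callable 9 [vs, as]"
proof (induction vs)
  case Atom
  show ?case by (rule callableI) (simp_all add: exec_simps)
next
  case (Cell v vs)
  with size_degree_in[of v as] show ?case
    by (intro callableI) (simp_all add: exec_simps callable_degree callable_longer algebra_simps)
qed

lemma callable_append: "callable 10 [k, l]"
  by (induction k; rule callableI) (simp_all add: exec_simps)

lemma callable_repeat: "callable 11 [k, l]"
  by (induction k; rule callableI) (simp_all add: exec_simps callable_append algebra_simps)

lemma callable_cut:
  assumes "len m \<le> len u \<Longrightarrow> query as u \<in> Q"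
  shows "callable 12 [as, m, b, u, s]"
  by (rule callableI)
    (use assms in \<open>simp_all add: exec_simps callable_longer_eq callable_union callable_induced
      cut_def cut_time_def query_time_def\<close>)

lemma callable_merge:
  assumes "len m \<le> len (union_list (data_fst r) (data_fst r')) \<Longrightarrow>
    query as (union_list (data_fst r) (data_fst r')) \<in> Q"
  shows "callable 13 [as, m, b, r, r']"
  by (rule callableI)
    (use assms in \<open>simp_all add: exec_simps callable_cut callable_union merge_def merge_time_def Let_def\<close>)

lemma callable_process_Atom:
  assumes "10 \<le> N"
  shows "callable 14 [as, m, b, Atom]"
  by (rule callableI) (use assms in \<open>simp_all add: exec_simps\<close>)

text \<open>The additional 50 pays for the part of the body around the call of \<open>merge\<close>,
  so that one \<open>N\<close> covers a whole step.\<close>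

lemma callable_process_Cell:
  assumes "callable 14 [as, m, b', us]" "callable 14 [as, m, b, ts]"
    and "len m \<le> len u \<Longrightarrow> query as u \<in> Q"
    and "merge_time as (process as m b' us) (process as m b ts) + 50 \<le> N"
    and "u = union_list (data_fst (process as m b' us)) (data_fst (process as m b ts))"
  shows "callable 14 [as, m, b, Cell (Cell b' us) ts]"
  by (rule callableI)
    (use assms in \<open>simp_all add: exec_simps callable_merge algebra_simps\<close>)

lemma callable_finish:
  assumes "query as (data_fst r) \<in> Q"
  shows "callable 15 [as, r]"
  by (rule callableI)
    (use assms in \<open>simp_all add: exec_simps callable_union callable_induced finish_def query_time_def\<close>)

lemma computes_mono: "computes env e v T \<Longrightarrow> T \<le> T' \<Longrightarrow> computes env e v T'"
  unfolding computes_def using le_trans by blast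

text \<open>The edgeless case avoids the oracle: with \<Delta> = 0 the permitted query size is 0,
  while the full vertex list is the only dominating set.\<close>

lemma computes_main_edgeless:
  "computes [Cell (Cell V Atom) t] (kernel_program K ! 0) (main (Cell (Cell V Atom) t)) 10"
proof -
  have "expr_ok [Cell (Cell V Atom) t] (kernel_program K ! 0)"
    "expr_value [Cell (Cell V Atom) t] (kernel_program K ! 0) = main (Cell (Cell V Atom) t)"
    "expr_time [Cell (Cell V Atom) t] (kernel_program K ! 0) \<le> 10"
    by (simp_all add: kernel_program_def main_def)
  with computes_mono[OF computes_expr[of "[Cell (Cell V Atom) t]" "kernel_program K ! 0"]]
  show ?thesis by (simp only:)
qed

lemma computes_main:
  fixes V as t :: data
  defines "f \<equiv> Cell t Atom" and "m \<equiv> threshold K (Cell V as) (Cell t Atom)"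
  assumes "as \<noteq> Atom" and "callable 14 [as, m, Atom, f]"
    and "query as (data_fst (process as m Atom f)) \<in> Q"
  shows "computes [Cell (Cell V as) t] (kernel_program K ! 0) (main (Cell (Cell V as) t))
    (fun_time 9 [V, as] + fun_time 7 [f] +
     fun_time 11 [max_bag f, Cell Atom (max_degree_in V as)] +
     fun_time 11 [unary K, repeat_list (max_bag f) (Cell Atom (max_degree_in V as))] +
     fun_time 14 [as, m, Atom, f] + fun_time 15 [as, process as m Atom f] + 100)"
    (is "computes ?env ?e ?v ?T")
proof -
  have val: "fun_value 9 [V, as] = max_degree_in V as" "fun_value 7 [f] = max_bag f"
    "\<And>k l. fun_value 11 [k, l] = repeat_list k l"
    "fun_value 14 [as, m, Atom, f] = process as m Atom f"
    "\<And>r. fun_value 15 [as, r] = finish as r"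
    by (simp_all add: fun_value_def del: process.simps max_bag.simps)
  note simps = val callable_max_degree callable_max_bag callable_repeat callable_finish
  let ?input = "Cell (Cell V as) t"
  \<comment> \<open>The computation of the threshold is executed separately, so that the remaining
    execution sees only the opaque value \<open>m\<close>.\<close>
  define e where "e = call_repeat (Quote (unary K))
     (call_repeat (call_max_bag (MkCell (Snd (Var 0)) (Quote Atom)))
       (MkCell (Quote Atom) (call_max_degree (Fst (Fst (Var 0))) (Snd (Fst (Var 0))))))"
  have e: "expr_ok ?env e" "expr_value ?env e = m" "expr_time ?env e \<le> fun_time 9 [V, as] +
     fun_time 7 [f] + fun_time 11 [max_bag f, Cell Atom (max_degree_in V as)] +
     fun_time 11 [unary K, repeat_list (max_bag f) (Cell Atom (max_degree_in V as))] + 40"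
    unfolding m_def threshold_def f_def[symmetric] e_def
    by (simp_all add: f_def[symmetric] simps del: process.simps max_bag.simps repeat_list.simps)
  have prog: "?e = If (Snd (Fst (Var 0)))
     (call_finish (Snd (Fst (Var 0)))
       (call_forest (Snd (Fst (Var 0))) e (Quote Atom) (MkCell (Snd (Var 0)) (Quote Atom))))
     (Fst (Fst (Var 0)))"
    by (simp add: kernel_program_def e_def)
  have "main ?input = finish as (process as m Atom f)"
    using assms(3) by (simp add: main_def m_def f_def Let_def del: process.simps)
  moreover have "expr_ok ?env ?e" "expr_value ?env ?e = finish as (process as m Atom f)"
    "expr_time ?env ?e \<le> ?T"
    unfolding prog using assms(3-5) e
    by (simp_all add: f_def[symmetric] simps del: process.simps)
  ultimately show ?thesis
    using computes_mono[OF computes_expr[of ?env ?e]] by (simp only:)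
qed

section \<open>A polynomial bound on the total time\<close>

lemma union_time_le:
  assumes "size k \<le> s" "size l \<le> s"
  shows "union_time k l \<le> 30 * (s + 1) ^ 2"
proof -
  have "union_time k l \<le> (s + 1) * (20 * s + 30)"
    unfolding union_time_def using assms by (intro mult_le_mono) auto
  also have "\<dots> \<le> 30 * (s + 1) ^ 2"
    by (simp add: power2_eq_square algebra_simps)
  finally show ?thesis .
qed

lemma query_time_le:
  assumes "size as \<le> s" "size u \<le> s" "size (orc (query as u)) \<le> s"
  shows "query_time as u \<le> 60 * (s + 1) ^ 2"
proof -
  have "(size as + 1) * (40 * size u + 50) \<le> (s + 1) * (40 * s + 50)"
    using assms by (intro mult_le_mono) auto
  moreover have "(s + 1) * (40 * s + 50) + (s + s + 1) + s \<le> 60 * (s + 1) ^ 2"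
    by (simp add: power2_eq_square algebra_simps)
  moreover have "size (query as u) \<le> s + s + 1"
    using size_induced_arcs[of as u] assms by simp
  ultimately show ?thesis
    unfolding query_time_def using assms(3) by linarith
qed

lemma merge_time_le:
  assumes "size as \<le> s" "size (data_fst r) \<le> s" "size (data_fst r') \<le> s"
    "size (data_snd r) \<le> s" "size (data_snd r') \<le> s"
    and "u = union_list (data_fst r) (data_fst r')" "size u \<le> s"
    and "size (union_list (data_snd r) (data_snd r')) \<le> s"
    and "size (orc (query as u)) \<le> s"
  shows "merge_time as r r' + 50 \<le> 310 * (s + 1) ^ 2"
proof -
  \<comment> \<open>The three unions contribute 90, the query 60 and the remaining terms 160, which
    makes 310.\<close>
  have "10 * s + 150 \<le> 160 * (s + 1) ^ 2"
    by (simp add: power2_eq_square)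
  then show ?thesis
    using union_time_le[OF assms(2,3)] union_time_le[OF assms(4,5)]
      union_time_le[OF assms(9,8)] query_time_le[OF assms(1,7,9)] assms(7)
    unfolding merge_time_def cut_time_def Let_def assms(6)[symmetric] by linarith
qed

text \<open>The cubic term stems from the traversal of the forest, linearly many steps of quadratic
  cost \<open>N\<close>. For fixed \<open>K\<close> everything else is quadratic.\<close>

lemma main_time_le:
  fixes V as t :: data
  defines "f \<equiv> Cell t Atom" and "s \<equiv> size (Cell (Cell V as) t)"
  assumes N: "N = 310 * (s + 1) ^ 2"
    and r: "size (data_fst r) \<le> s" "size (data_snd r) \<le> s" "size (orc (query as (data_fst r))) \<le> s"
  shows "fun_time 9 [V, as] + fun_time 7 [f] +
     fun_time 11 [max_bag f, Cell Atom (max_degree_in V as)] +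
     fun_time 11 [unary K, repeat_list (max_bag f) (Cell Atom (max_degree_in V as))] +
     fun_time 14 [as, m, Atom, f] + fun_time 15 [as, r] + 100 \<le> (40 * K + 2000) * (s + 1) ^ 3"
proof -
  let ?z = "s + 1"
  have f: "size f \<le> s" and V: "size V \<le> s" and as: "size as \<le> s"
    by (simp_all add: f_def s_def)
  have len: "len (max_bag f) \<le> s"
    using len_le_size[of "max_bag f"] size_max_bag[of f] f by linarith
  have size: "size (max_bag f) \<le> s" "size (max_degree_in V as) \<le> s"
    using size_max_bag[of f] f size_max_degree_in[of V as] as by linarith+
  have pow: "?z ^ 2 \<le> ?z ^ 3" "1 \<le> ?z ^ 2"
    by (intro power_increasing) auto
  have 9: "fun_time 9 [V, as] \<le> 60 * ?z ^ 2"
  proof -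
    have "(size V + 1) * (40 * size as + 60) \<le> (s + 1) * (40 * s + 60)"
      using V as by (intro mult_le_mono) auto
    also have "\<dots> \<le> 60 * ?z ^ 2" by (simp add: power2_eq_square algebra_simps)
    finally show ?thesis by (simp add: fun_time_def)
  qed
  have 7: "fun_time 7 [f] \<le> 140 * ?z ^ 2"
  proof -
    have "(2 * size f + 1) * (20 * size f + 70) \<le> (2 * s + 1) * (20 * s + 70)"
      using f by (intro mult_le_mono) auto
    also have "\<dots> \<le> 140 * ?z ^ 2" by (simp add: power2_eq_square algebra_simps)
    finally show ?thesis by (simp add: fun_time_def)
  qed
  have 11: "fun_time 11 [max_bag f, Cell Atom (max_degree_in V as)] \<le> 50 * ?z ^ 2"
  proof -
    have "(size (max_bag f) + 1) * (10 * size (Cell Atom (max_degree_in V as)) + 30)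
        \<le> (s + 1) * (10 * (s + 1) + 30)"
      using size by (intro mult_le_mono) auto
    also have "\<dots> \<le> 50 * ?z ^ 2" by (simp add: power2_eq_square algebra_simps)
    finally show ?thesis by (simp add: fun_time_def)
  qed
  have repeat_K: "fun_time 11 [unary K, repeat_list (max_bag f) (Cell Atom (max_degree_in V as))]
      \<le> (K + 1) * (40 * ?z ^ 2)"
  proof -
    have "len (max_bag f) * size (Cell Atom (max_degree_in V as)) \<le> s * (s + 1)"
      using len size by (intro mult_le_mono) auto
    also have "\<dots> \<le> ?z ^ 2" by (simp add: power2_eq_square)
    finally have "10 * (len (max_bag f) * size (Cell Atom (max_degree_in V as))) + 30 \<le> 40 * ?z ^ 2"
      using pow(2) by linarith
    then have "(K + 1) * (10 * (len (max_bag f) * size (Cell Atom (max_degree_in V as))) + 30)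
        \<le> (K + 1) * (40 * ?z ^ 2)"
      by (rule mult_le_mono2)
    then show ?thesis
      by (simp add: fun_time_def size_unary size_repeat_list)
  qed
  have 14: "fun_time 14 [as, m, Atom, f] \<le> 620 * ?z ^ 3"
  proof -
    have "(2 * size f + 1) * N \<le> (2 * ?z) * (310 * ?z ^ 2)"
      unfolding N using f by (intro mult_le_mono) auto
    also have "\<dots> = 620 * ?z ^ 3" by (simp only: power2_eq_square power3_eq_cube)
    finally show ?thesis by (simp add: fun_time_def)
  qed
  have 15: "fun_time 15 [as, r] \<le> 140 * ?z ^ 2"
  proof -
    have "fun_time 15 [as, r] =
        query_time as (data_fst r) + union_time (orc (query as (data_fst r))) (data_snd r) + 50"
      by (simp add: fun_time_def)
    then show ?thesis
      using query_time_le[OF as r(1,3)] union_time_le[OF r(3,2)] pow(2) by linarith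
  qed
  have "(K + 1) * (40 * ?z ^ 2) \<le> (K + 1) * (40 * ?z ^ 3)"
    using pow(1) by (intro mult_le_mono2) auto
  then have "(K + 1) * (40 * ?z ^ 2) \<le> 40 * K * ?z ^ 3 + 40 * ?z ^ 3"
    by (simp add: algebra_simps)
  then have "fun_time 9 [V, as] + fun_time 7 [f] +
     fun_time 11 [max_bag f, Cell Atom (max_degree_in V as)] +
     fun_time 11 [unary K, repeat_list (max_bag f) (Cell Atom (max_degree_in V as))] +
     fun_time 14 [as, m, Atom, f] + fun_time 15 [as, r] + 100 \<le> 40 * K * ?z ^ 3 + 2000 * ?z ^ 3"
    using 9 7 11 repeat_K 14 15 pow by linarith
  then show ?thesis by (simp only: distrib_right)
qed

end

section \<open>Correctness of the list functions on encodings\<close>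

abbreviation enc_set :: "data \<Rightarrow> nat set \<Rightarrow> bool" where
  "enc_set \<equiv> encodes_set enc_nat"

text \<open>Parity and half determine a number. Injectivity turns the structural comparison of
  encodings into an equality test for vertices.\<close>

lemma inj_enc_nat: "inj enc_nat"
proof (rule injI)
  show "a = b" if "enc_nat a = enc_nat b" for a b
    using that
  proof (induction a arbitrary: b rule: less_induct)
    case (less a)
    show ?case
    proof (cases "a = 0 \<or> b = 0")
      case True
      with less.prems show ?thesis
        \<comment> \<open>Both sides are unfolded exactly once, as the defining equation would loop
          as a rewrite rule.\<close>
        by (subst (asm) (1 2) enc_nat.simps) (auto split: if_splits)
    next
      case False
      with less.prems have "enc_nat (a div 2) = enc_nat (b div 2)" "odd a = odd b"
        by (subst (asm) (1 2) enc_nat.simps; simp split: if_splits)+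
      moreover from this(1) less.IH[of "a div 2" "b div 2"] False have "a div 2 = b div 2"
        by simp
      ultimately show ?thesis
        by (metis even_two_times_div_two odd_two_times_div_two_succ)
    qed
  qed
qed

lemma enc_list_simps [simp]:
  "enc_list [] = Atom" "enc_list (d # ds) = Cell d (enc_list ds)"
  by (simp_all add: enc_list_def)

lemma mem_enc_list: "mem x (enc_list ds) \<longleftrightarrow> x \<in> set ds"
  by (induction ds) auto

lemma size_enc_list: "size (enc_list ds) = (\<Sum>d\<leftarrow>ds. Suc (size d))"
  by (induction ds) auto

lemma len_enc_list: "len (enc_list ds) = length ds"
  by (induction ds) auto

lemma mem_enc_set:
  assumes "encodes_set enc d X" "inj enc"
  shows "mem (enc x) d \<longleftrightarrow> x \<in> X"
  using assms by (auto simp: encodes_set_def mem_enc_list dest: injD)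

lemma len_encodes_set: "encodes_set enc d X \<Longrightarrow> len d = card X"
  by (auto simp: encodes_set_def len_enc_list distinct_card)

text \<open>The size is a sum over the elements and does not depend on their order. Hence no
  intermediate vertex list and no oracle answer can outgrow the vertex list of the input.\<close>

lemma size_encodes_set_mono:
  assumes "encodes_set enc d X" "encodes_set enc d' Y" "X \<subseteq> Y"
  shows "size d \<le> size d'"
proof -
  from assms(1) obtain xs where xs: "distinct xs" "set xs = X" "d = enc_list (map enc xs)"
    by (auto simp: encodes_set_def)
  from assms(2) obtain ys where ys: "distinct ys" "set ys = Y" "d' = enc_list (map enc ys)"
    by (auto simp: encodes_set_def)
  have "size d = (\<Sum>x\<in>X. Suc (size (enc x)))"
    using xs by (simp add: size_enc_list comp_def sum_list_distinct_conv_sum_set)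
  also have "\<dots> \<le> (\<Sum>x\<in>Y. Suc (size (enc x)))"
    using assms(3) ys(2) by (intro sum_mono2) auto
  also have "\<dots> = size d'"
    using ys by (simp add: size_enc_list comp_def sum_list_distinct_conv_sum_set)
  finally show ?thesis .
qed

lemma encodes_set_Atom [simp]: "encodes_set enc Atom X \<longleftrightarrow> X = {}"
proof
  assume "encodes_set enc Atom X"
  then obtain xs where "set xs = X" "Atom = enc_list (map enc xs)" by (auto simp: encodes_set_def)
  then show "X = {}" by (cases xs) auto
next
  assume "X = {}"
  then show "encodes_set enc Atom X" by (auto simp: encodes_set_def intro!: exI[of _ "[]"])
qed

lemma encodes_set_union_list:
  assumes "inj enc" "encodes_set enc a X" "encodes_set enc b Y"
  shows "encodes_set enc (union_list a b) (X \<union> Y)"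
proof -
  from assms(2) obtain xs where xs: "distinct xs" "set xs = X" "a = enc_list (map enc xs)"
    by (auto simp: encodes_set_def)
  from assms(3) obtain ys where ys: "distinct ys" "set ys = Y" "b = enc_list (map enc ys)"
    by (auto simp: encodes_set_def)
  have "union_list (enc_list (map enc xs)) b = enc_list (map enc (filter (\<lambda>x. x \<notin> Y) xs @ ys))"
    by (induction xs) (simp_all add: ys(3) mem_enc_set[OF assms(3,1), unfolded ys(3)])
  then show ?thesis
    unfolding encodes_set_def xs(3) using xs(1,2) ys(1,2)
    by (intro exI[of _ "filter (\<lambda>x. x \<notin> Y) xs @ ys"]) auto
qed

lemma encodes_set_induced_arcs:
  assumes "encodes_set enc_arc a E" "enc_set u U"
  shows "encodes_set enc_arc (induced_arcs a u) (E \<inter> U \<times> U)"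
proof -
  from assms(1) obtain es where es: "distinct es" "set es = E" "a = enc_list (map enc_arc es)"
    by (auto simp: encodes_set_def)
  have "induced_arcs (enc_list (map enc_arc es)) u
      = enc_list (map enc_arc (filter (\<lambda>e. e \<in> U \<times> U) es))"
    by (induction es) (auto simp: enc_arc_def mem_enc_set[OF assms(2) inj_enc_nat] mem_Times_iff)
  then show ?thesis
    unfolding encodes_set_def es(3) using es(1,2)
    by (intro exI[of _ "filter (\<lambda>e. e \<in> U \<times> U) es"]) auto
qed

section \<open>Lengths, the ingredients of the threshold\<close>

lemma len_longer: "len (longer k l) = max (len k) (len l)"
  by (simp add: longer_def)

lemma len_append_list: "len (append_list k l) = len k + len l"
  by (induction k) auto

lemma len_repeat_list: "len (repeat_list k l) = len k * len l"
  by (induction k) (auto simp: len_append_list)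

lemma len_degree_in:
  assumes "encodes_set enc_arc a (parcs G)"
  shows "len (degree_in (enc_nat v) a) = out_degree (with_proj G) v"
proof -
  from assms obtain es where es: "distinct es" "set es = parcs G" "a = enc_list (map enc_arc es)"
    by (auto simp: encodes_set_def)
  have "len (degree_in (enc_nat v) (enc_list (map enc_arc es))) = length (filter (\<lambda>e. fst e = v) es)"
    by (induction es) (auto simp: enc_arc_def dest: injD[OF inj_enc_nat])
  also have "\<dots> = card {e \<in> parcs G. fst e = v}"
    using es(1,2) by (metis distinct_card distinct_filter set_filter)
  finally show ?thesis
    unfolding es(3) by (simp add: out_degree_def out_arcs_def)
qed

lemma len_max_degree_in:
  assumes "enc_set d (pverts G)" "encodes_set enc_arc a (parcs G)"
  shows "len (max_degree_in d a) = max_degree G"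
proof -
  from assms(1) obtain vs where vs: "set vs = pverts G" "d = enc_list (map enc_nat vs)"
    by (auto simp: encodes_set_def)
  have "len (max_degree_in (enc_list (map enc_nat vs)) a)
      = Max (insert 0 (out_degree (with_proj G) ` set vs))"
  proof (induction vs)
    case (Cons v vs)
    then show ?case
      by (simp add: len_longer len_degree_in[OF assms(2)] insert_commute[of 0])
  qed simp
  then show ?thesis
    by (simp add: max_degree_def vs)
qed

subsection \<open>Forests\<close>

text \<open>Replaces the nested recursion of \<open>rtree\<close> by a binary one, into the children
  of the first tree and its later siblings. This is the recursion pattern of \<open>max_bag\<close>
  and \<open>process\<close>.\<close>

lemma forest_induct [case_names Nil Cons]:
  assumes "P []"
    and "\<And>a us ts. P us \<Longrightarrow> P ts \<Longrightarrow> P (Node a us # ts)"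
  shows "P ts"
proof (induction ts rule: measure_induct_rule[of "size_list size"])
  case (less ts)
  show ?case
  proof (cases ts)
    case Nil
    with assms(1) show ?thesis by simp
  next
    case (Cons t ts')
    then show ?thesis
      using assms(2)[of "children t" ts' "label t"] less[of "children t"] less[of ts']
      by (cases t) simp
  qed
qed

definition bags :: "'a rtree list \<Rightarrow> 'a set" where
  "bags ts = (\<Union>t\<in>set ts. set_rtree t)"

lemma bags_simps [simp]:
  "bags [] = {}" "bags (Node b us # ts) = insert b (bags us \<union> bags ts)"
  by (auto simp: bags_def)

abbreviation enc_forest :: "nat list rtree list \<Rightarrow> data" where
  "enc_forest ts \<equiv> enc_list (map (enc_rtree (\<lambda>xs. enc_list (map enc_nat xs))) ts)"

text \<open>Comparison with an arbitrary \<open>n\<close> describes the maximum without a special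
  case for the empty forest.\<close>

lemma len_max_bag: "len (max_bag (enc_forest ts)) \<le> n \<longleftrightarrow> (\<forall>b\<in>bags ts. length b \<le> n)"
  by (induction ts rule: forest_induct) (auto simp: len_longer len_enc_list)

section \<open>Domination in pieces of a graph\<close>

definition induced :: "'a pair_pre_digraph \<Rightarrow> 'a set \<Rightarrow> 'a pair_pre_digraph" where
  "induced G U = \<lparr>pverts = U, parcs = parcs G \<inter> U \<times> U\<rparr>"

lemma induced_simps [simp]:
  "pverts (induced G U) = U" "parcs (induced G U) = parcs G \<inter> U \<times> U"
  by (simp_all add: induced_def)

lemma pair_graph_sym: "pair_graph G \<Longrightarrow> (u, v) \<in> parcs G \<Longrightarrow> (v, u) \<in> parcs G"
  using pair_sym_digraph.pair_sym_arcs[of G]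
  by (auto simp: symmetric_def sym_def pair_graph_def pair_pseudo_graph_def)

lemma pair_graph_induced:
  assumes "pair_graph G" "U \<subseteq> pverts G"
  shows "pair_graph (induced G U)"
proof -
  interpret pair_graph G by fact
  show ?thesis
  proof
    show "finite (pverts (induced G U))"
      using assms(2) pair_finite_verts by (simp add: finite_subset)
    show "symmetric (with_proj (induced G U))"
      using pair_graph_sym[OF assms(1)] by (auto simp: symmetric_def sym_def)
  qed (use pair_finite_arcs no_loops in auto)
qed

section \<open>Domination numbers\<close>

lemma domination_number_le: "dominating_set G X \<Longrightarrow> domination_number G \<le> card X"
  unfolding domination_number_def by (rule Least_le) blast

lemma domination_number_attained:
  assumes "pair_graph G"
  shows "\<exists>X. dominating_set G X \<and> card X = domination_number G"
proof -
  interpret pair_graph G by fact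
  have "dominating_set G (pverts G)"
    by (auto simp: dominating_set_def closed_nbhd_def dest: in_arcsD2)
  then have "\<exists>n X. dominating_set G X \<and> card X = n" by blast
  then show ?thesis
    unfolding domination_number_def by (rule LeastI_ex)
qed

lemma card_nbhd_le_max_degree:
  assumes "pair_graph G" "x \<in> pverts G"
  shows "card {v. (x, v) \<in> parcs G} \<le> max_degree G"
proof -
  interpret pair_graph G by fact
  have "card {v. (x, v) \<in> parcs G} = card (Pair x ` {v. (x, v) \<in> parcs G})"
    by (simp add: card_image inj_on_def)
  also have "Pair x ` {v. (x, v) \<in> parcs G} = out_arcs (with_proj G) x"
    by (auto simp: out_arcs_def)
  also have "card \<dots> \<le> max_degree G"
    using assms(2) pair_finite_verts by (auto simp: max_degree_def out_degree_def intro!: Max_ge)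
  finally show ?thesis .
qed

text \<open>Each vertex dominates at most \<open>max_degree G + 1\<close> vertices. This relates the
  vertices used up by the cuts to an optimum solution.\<close>

lemma card_verts_le_dominating_set:
  assumes "pair_graph G" "dominating_set G D"
  shows "card (pverts G) \<le> card D * (max_degree G + 1)"
proof -
  interpret pair_graph G by fact
  have fin: "finite D"
    using assms(2) pair_finite_verts by (auto simp: dominating_set_def intro: finite_subset)
  have "pverts G = (\<Union>x\<in>D. insert x {v. (x, v) \<in> parcs G})"
    using assms(2) by (auto simp: dominating_set_def closed_nbhd_def)
  also have "card \<dots> \<le> (\<Sum>x\<in>D. card (insert x {v. (x, v) \<in> parcs G}))"
    by (rule card_UN_le[OF fin])
  also have "\<dots> \<le> (\<Sum>x\<in>D. max_degree G + 1)"
  proof (rule sum_mono)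
    fix x assume "x \<in> D"
    with assms(2) have "x \<in> pverts G" by (auto simp: dominating_set_def)
    from card_nbhd_le_max_degree[OF assms(1) this]
    show "card (insert x {v. (x, v) \<in> parcs G}) \<le> max_degree G + 1"
      using card_insert_le_m1[of "max_degree G + 1" "{v. (x, v) \<in> parcs G}" x] by simp
  qed
  finally show ?thesis by simp
qed

text \<open>
  The vertices of \<open>I\<close> have all their neighbours in \<open>U\<close>, so an optimum solution of the whole graph
  only fails to dominate vertices of \<open>U - I\<close> from within \<open>U\<close>; these are simply added.
\<close>

lemma domination_number_induced_le:
  assumes G: "pair_graph G" and D: "dominating_set G D"
    and U: "U \<subseteq> pverts G" and I: "I \<subseteq> U"
    and nbhd: "\<And>v w. v \<in> I \<Longrightarrow> (v, w) \<in> parcs G \<Longrightarrow> w \<in> U"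
  shows "domination_number (induced G U) \<le> card (D \<inter> I) + card (U - I)"
proof -
  let ?X = "(D \<inter> I) \<union> (U - I)"
  have "v \<in> closed_nbhd (induced G U) ?X" if v: "v \<in> U" for v
  proof (cases "v \<in> I \<and> v \<notin> D")
    case True
    from v U D have "v \<in> closed_nbhd G D" by (auto simp: dominating_set_def)
    with True obtain d where d: "d \<in> D" "(d, v) \<in> parcs G"
      by (auto simp: closed_nbhd_def)
    from nbhd[OF _ pair_graph_sym[OF G d(2)]] True have "d \<in> U" by blast
    with d v show ?thesis by (auto simp: closed_nbhd_def)
  qed (use v in \<open>auto simp: closed_nbhd_def\<close>)
  then have "dominating_set (induced G U) ?X"
    using I by (auto simp: dominating_set_def closed_nbhd_def)
  from domination_number_le[OF this] card_Un_le[of "D \<inter> I" "U - I"] show ?thesis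
    by linarith
qed

section \<open>The invariant of the forest recursion\<close>

text \<open>
  \<open>B\<close> is the current bag and \<open>\<B>\<close> the set of bags processed so far, \<open>U\<close> the set of pending vertices
  and \<open>S\<close> the partial solution. Hidden in the invariant are the set \<open>F\<close> of vertices that were
  interior to a query, the set \<open>R\<close> of pending vertices that already occurred in a cut bag, the
  total number \<open>d\<close> of boundary vertices of the queries and the number \<open>q\<close> of queries. Each cut
  makes its bag part of the boundary of the query and of \<open>R\<close>, whence the bound \<open>2 * w * q\<close>.
\<close>

locale domination_instance =
  fixes G :: "'a pair_pre_digraph" and D :: "'a set" and c :: real and w M :: nat
  assumes G: "pair_graph G" and D: "dominating_set G D" and c: "c \<ge> 0"
begin

sublocale pair_graph G by (rule G)

definition invar :: "'a set \<Rightarrow> 'a set set \<Rightarrow> 'a set \<Rightarrow> 'a set \<Rightarrow> bool" where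
  "invar B \<B> U S \<longleftrightarrow> (\<exists>F R d q.
     B \<subseteq> U \<and> U \<subseteq> \<Union>\<B> \<and> F \<subseteq> \<Union>\<B> \<and> F \<inter> U = {} \<and> R \<subseteq> U \<and>
     (\<forall>b\<in>\<B>. b \<inter> (U - R) \<noteq> {} \<longrightarrow> b \<subseteq> U) \<and>
     S \<subseteq> pverts G \<and> \<Union>\<B> \<subseteq> U \<union> closed_nbhd G S \<and>
     card S \<le> c * (card (D \<inter> F) + d) \<and>
     d + card R \<le> 2 * w * q \<and> q * M \<le> card F + d)"

lemma invarE:
  assumes "invar B \<B> U S"
  obtains F R d q where
     "B \<subseteq> U" "U \<subseteq> \<Union>\<B>" "F \<subseteq> \<Union>\<B>" "F \<inter> U = {}" "R \<subseteq> U"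
     "\<And>b. b \<in> \<B> \<Longrightarrow> b \<inter> (U - R) \<noteq> {} \<Longrightarrow> b \<subseteq> U"
     "S \<subseteq> pverts G" "\<Union>\<B> \<subseteq> U \<union> closed_nbhd G S"
     "card S \<le> c * (card (D \<inter> F) + d)"
     "d + card R \<le> 2 * w * q" "q * M \<le> card F + d"
proof -
  from assms obtain F R d q where *: "B \<subseteq> U" "U \<subseteq> \<Union>\<B>" "F \<subseteq> \<Union>\<B>" "F \<inter> U = {}" "R \<subseteq> U"
     "\<forall>b\<in>\<B>. b \<inter> (U - R) \<noteq> {} \<longrightarrow> b \<subseteq> U"
     "S \<subseteq> pverts G" "\<Union>\<B> \<subseteq> U \<union> closed_nbhd G S"
     "card S \<le> c * (card (D \<inter> F) + d)"
     "d + card R \<le> 2 * w * q" "q * M \<le> card F + d"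
    unfolding invar_def by (elim exE conjE) (rule that)
  have "\<And>b. b \<in> \<B> \<Longrightarrow> b \<inter> (U - R) \<noteq> {} \<Longrightarrow> b \<subseteq> U" using *(6) by blast
  from *(1-5) this *(7-11) show ?thesis by (rule that)
qed

lemma invarI:
  assumes "B \<subseteq> U" "U \<subseteq> \<Union>\<B>" "F \<subseteq> \<Union>\<B>" "F \<inter> U = {}" "R \<subseteq> U"
     "\<And>b. b \<in> \<B> \<Longrightarrow> b \<inter> (U - R) \<noteq> {} \<Longrightarrow> b \<subseteq> U"
     "S \<subseteq> pverts G" "\<Union>\<B> \<subseteq> U \<union> closed_nbhd G S"
     "card S \<le> c * (card (D \<inter> F) + d)"
     "d + card R \<le> 2 * w * q" "q * M \<le> card F + d"
  shows "invar B \<B> U S"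
proof -
  have "\<forall>b\<in>\<B>. b \<inter> (U - R) \<noteq> {} \<longrightarrow> b \<subseteq> U" using assms(6) by blast
  note * = assms(1-5) this assms(7-11)
  show ?thesis
    unfolding invar_def
    by (rule exI[of _ F], rule exI[of _ R], rule exI[of _ d], rule exI[of _ q]) (intro conjI *)
qed

lemma closed_nbhd_Un: "closed_nbhd G (X \<union> Y) = closed_nbhd G X \<union> closed_nbhd G Y"
  by (auto simp: closed_nbhd_def)

lemma closed_nbhd_induced: "closed_nbhd (induced G U) X \<subseteq> closed_nbhd G X"
  by (auto simp: closed_nbhd_def)

lemma invar_pending:
  assumes "invar B \<B> U S"
  shows "B \<subseteq> U" "U \<subseteq> \<Union>\<B>" "S \<subseteq> pverts G"
  by (rule invarE[OF assms], assumption)+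

lemma invar_init: "invar B {B} B {}"
  by (rule invarI[of _ _ _ "{}" "{}" _ 0 0]) auto

text \<open>All counters add up. By separation, a vertex common to both sides lies in
  \<open>B\<close> and \<open>C\<close> and is therefore pending on both sides, so the vertices
  interior on one side neither occur in \<open>F\<close> nor are pending on the other.\<close>

lemma invar_merge:
  assumes "invar C \<C> U S" "invar B \<B> U' S'"
    and fin: "\<Union>\<C> \<union> \<Union>\<B> \<subseteq> pverts G"
    and sep: "\<Union>\<C> \<inter> \<Union>\<B> \<subseteq> B \<inter> C"
  shows "invar B (\<C> \<union> \<B>) (U \<union> U') (S \<union> S')"
proof -
  obtain F R d q where 1: "C \<subseteq> U" "U \<subseteq> \<Union>\<C>" "F \<subseteq> \<Union>\<C>" "F \<inter> U = {}" "R \<subseteq> U"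
     "\<And>b. b \<in> \<C> \<Longrightarrow> b \<inter> (U - R) \<noteq> {} \<Longrightarrow> b \<subseteq> U"
     "S \<subseteq> pverts G" "\<Union>\<C> \<subseteq> U \<union> closed_nbhd G S"
     "card S \<le> c * (card (D \<inter> F) + d)"
     "d + card R \<le> 2 * w * q" "q * M \<le> card F + d"
    using assms(1) by (rule invarE) (rule that)
  obtain F' R' d' q' where 2: "B \<subseteq> U'" "U' \<subseteq> \<Union>\<B>" "F' \<subseteq> \<Union>\<B>" "F' \<inter> U' = {}" "R' \<subseteq> U'"
     "\<And>b. b \<in> \<B> \<Longrightarrow> b \<inter> (U' - R') \<noteq> {} \<Longrightarrow> b \<subseteq> U'"
     "S' \<subseteq> pverts G" "\<Union>\<B> \<subseteq> U' \<union> closed_nbhd G S'"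
     "card S' \<le> c * (card (D \<inter> F') + d')"
     "d' + card R' \<le> 2 * w * q'" "q' * M \<le> card F' + d'"
    using assms(2) by (rule invarE) (rule that)
  have fins: "finite F" "finite F'"
    using finite_subset[OF 1(3)] finite_subset[OF 2(3)] finite_subset[OF _ pair_finite_verts] fin
    by auto
  have disj: "F \<inter> F' = {}" and disjU: "F \<inter> U' = {}" "F' \<inter> U = {}"
    using 1(1-4) 2(1-4) sep by blast+
  have cardF: "card (F \<union> F') = card F + card F'"
    using fins disj by (rule card_Un_disjoint)
  have cardD: "card (D \<inter> (F \<union> F')) = card (D \<inter> F) + card (D \<inter> F')"
    unfolding Int_Un_distrib using fins disj by (intro card_Un_disjoint) auto
  have nums: "card (S \<union> S') \<le> c * (card (D \<inter> (F \<union> F')) + (d + d'))"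
    "d + d' + card (R \<union> R') \<le> 2 * w * (q + q')"
    "(q + q') * M \<le> card (F \<union> F') + (d + d')"
  proof -
    have "c * (card (D \<inter> (F \<union> F')) + (d + d'))
        = c * (card (D \<inter> F) + d) + c * (card (D \<inter> F') + d')"
      unfolding cardD by (simp add: algebra_simps)
    then show "card (S \<union> S') \<le> c * (card (D \<inter> (F \<union> F')) + (d + d'))"
      using 1(9) 2(9) card_Un_le[of S S'] by linarith
    show "d + d' + card (R \<union> R') \<le> 2 * w * (q + q')"
      unfolding distrib_left using 1(10) 2(10) card_Un_le[of R R'] by linarith
    show "(q + q') * M \<le> card (F \<union> F') + (d + d')"
      unfolding distrib_right cardF using 1(11) 2(11) by linarith
  qed
  show ?thesis
  proof (rule invarI[of _ _ _ "F \<union> F'" "R \<union> R'" _ "d + d'" "q + q'"])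
    show "(F \<union> F') \<inter> (U \<union> U') = {}"
      using 1(4) 2(4) disjU by blast
    show "b \<subseteq> U \<union> U'" if b: "b \<in> \<C> \<union> \<B>" "b \<inter> (U \<union> U' - (R \<union> R')) \<noteq> {}" for b
    proof -
      from b(2) obtain v where v: "v \<in> b" "v \<in> U \<union> U'" "v \<notin> R" "v \<notin> R'" by blast
      show ?thesis
      \<comment> \<open>If \<open>v\<close> lies in a bag of one side and is pending on the other,
        it is shared, hence pending on its own side as well.\<close>
      proof (cases "b \<in> \<C>")
        case True
        with v 1(1) 2(2) sep have "v \<in> U" by blast
        with 1(6)[OF True] v show ?thesis by blast
      next
        case False
        with b(1) have "b \<in> \<B>" by blast
        moreover from this v 2(1) 1(2) sep have "v \<in> U'" by blast
        ultimately show ?thesis using 2(6)[of b] v by blast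
      qed
    qed
    show "\<Union>(\<C> \<union> \<B>) \<subseteq> (U \<union> U') \<union> closed_nbhd G (S \<union> S')"
      using 1(8) 2(8) unfolding closed_nbhd_Un by blast
    show "B \<subseteq> U \<union> U'" using 2(1) by blast
    show "U \<union> U' \<subseteq> \<Union>(\<C> \<union> \<B>)" using 1(2) 2(2) by blast
    show "F \<union> F' \<subseteq> \<Union>(\<C> \<union> \<B>)" using 1(3) 2(3) by blast
    show "R \<union> R' \<subseteq> U \<union> U'" using 1(5) 2(5) by blast
    show "S \<union> S' \<subseteq> pverts G" using 1(7) 2(7) by blast
  qed (fact nums)+
qed

text \<open>Shared by a cut and the final query. The interior vertices of \<open>U\<close> join
  \<open>F\<close> and the boundary vertices are added to \<open>d\<close>, whereas \<open>q\<close>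
  does not count the new query yet.\<close>

lemma invar_query:
  assumes inv: "invar B \<B> U S"
    and fin: "\<Union>\<B> \<subseteq> pverts G"
    and arcs: "\<And>v x. v \<in> \<Union>\<B> - B \<Longrightarrow> (v, x) \<in> parcs G \<Longrightarrow> \<exists>b\<in>\<B>. v \<in> b \<and> x \<in> b"
    and X: "dominating_set (induced G U) X" "card X \<le> c * domination_number (induced G U)"
  obtains F d q where "F \<subseteq> \<Union>\<B>" "F \<inter> B = {}" "X \<union> S \<subseteq> pverts G"
    "\<Union>\<B> \<subseteq> closed_nbhd G (X \<union> S)"
    "card (X \<union> S) \<le> c * (card (D \<inter> F) + d)"
    "d \<le> 2 * w * q + card B" "q * M + card U \<le> card F + d"
proof -
  obtain F R d q where I: "B \<subseteq> U" "U \<subseteq> \<Union>\<B>" "F \<subseteq> \<Union>\<B>" "F \<inter> U = {}" "R \<subseteq> U"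
     "\<And>b. b \<in> \<B> \<Longrightarrow> b \<inter> (U - R) \<noteq> {} \<Longrightarrow> b \<subseteq> U"
     "S \<subseteq> pverts G" "\<Union>\<B> \<subseteq> U \<union> closed_nbhd G S"
     "card S \<le> c * (card (D \<inter> F) + d)"
     "d + card R \<le> 2 * w * q" "q * M \<le> card F + d"
    using inv by (rule invarE) (rule that)
  let ?I = "U - (R \<union> B)"
  have finU: "finite U" and finF: "finite F"
    using finite_subset[OF I(2)] finite_subset[OF I(3)] finite_subset[OF _ pair_finite_verts] fin
    by auto
  have bd: "U - ?I = R \<union> B" using I(1,5) by blast
  have disj: "F \<inter> ?I = {}" using I(4) by blast
  have "domination_number (induced G U) \<le> card (D \<inter> ?I) + card (U - ?I)"
  proof (rule domination_number_induced_le[OF G D])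
    show "U \<subseteq> pverts G" using I(2) fin by (rule subset_trans)
    show "x \<in> U" if v: "v \<in> ?I" and vx: "(v, x) \<in> parcs G" for v x
    proof -
      from v I(2) have "v \<in> \<Union>\<B> - B" by blast
      from arcs[OF this vx] obtain b where b: "b \<in> \<B>" "v \<in> b" "x \<in> b" by blast
      \<comment> \<open>As \<open>v\<close> lies outside \<open>R\<close>, every processed bag
        containing it is still pending, in particular the one shared with its neighbour
        \<open>x\<close>.\<close>
      with v have "b \<inter> (U - R) \<noteq> {}" by blast
      from I(6)[OF b(1) this] b(3) show "x \<in> U" by blast
    qed
  qed (rule Diff_subset)
  then have "real (domination_number (induced G U)) \<le> card (D \<inter> ?I) + card (R \<union> B)"
    unfolding bd by (rule of_nat_mono)
  from mult_left_mono[OF this c] X(2)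
  have "card X \<le> c * (card (D \<inter> ?I) + card (R \<union> B))"
    by (rule order_trans[rotated])
  moreover have "card (D \<inter> (F \<union> ?I)) = card (D \<inter> F) + card (D \<inter> ?I)"
    unfolding Int_Un_distrib using finF finU disj by (intro card_Un_disjoint) auto
  then have "c * (card (D \<inter> (F \<union> ?I)) + (d + card (R \<union> B)))
      = c * (card (D \<inter> F) + d) + c * (card (D \<inter> ?I) + card (R \<union> B))"
    by (simp add: algebra_simps)
  ultimately have "card (X \<union> S) \<le> c * (card (D \<inter> (F \<union> ?I)) + (d + card (R \<union> B)))"
    using I(9) card_Un_le[of X S] by linarith
  moreover have "d + card (R \<union> B) \<le> 2 * w * q + card B"
    using I(10) card_Un_le[of R B] by linarith
  moreover have "q * M + card U \<le> card (F \<union> ?I) + (d + card (R \<union> B))"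
  proof -
    have "card (F \<union> ?I) = card F + card ?I"
      using finF finU disj by (intro card_Un_disjoint) simp_all
    \<comment> \<open>Every pending vertex is counted once, as interior or as boundary, which yields
      the surplus \<open>card U\<close>.\<close>
    moreover have "card U = card ?I + card (U - ?I)"
      using card_Un_disjoint[of ?I "U - ?I"] finU by (simp add: Un_absorb1)
    ultimately show ?thesis using I(11) unfolding bd by linarith
  qed
  moreover have "X \<union> S \<subseteq> pverts G"
  proof -
    have "X \<subseteq> U" using X(1) by (simp add: dominating_set_def)
    with I(2,7) fin show ?thesis by blast
  qed
  moreover have "\<Union>\<B> \<subseteq> closed_nbhd G (X \<union> S)"
  proof -
    have "U \<subseteq> closed_nbhd G X"
      using closed_nbhd_induced[of U X] X(1) by (simp add: dominating_set_def)
    with I(8) show ?thesis unfolding closed_nbhd_Un by blast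
  qed
  moreover have "F \<union> ?I \<subseteq> \<Union>\<B>" "(F \<union> ?I) \<inter> B = {}" using I(1-4) by blast+
  ultimately show ?thesis by (intro that)
qed

lemma invar_cut:
  assumes "invar B \<B> U S" and "B \<in> \<B>" "\<Union>\<B> \<subseteq> pverts G"
    and "\<And>v x. v \<in> \<Union>\<B> - B \<Longrightarrow> (v, x) \<in> parcs G \<Longrightarrow> \<exists>b\<in>\<B>. v \<in> b \<and> x \<in> b"
    and "dominating_set (induced G U) X" "card X \<le> c * domination_number (induced G U)"
    and M: "M \<le> card U" and B: "card B \<le> w"
  shows "invar B \<B> B (X \<union> S)"
proof -
  obtain F d q where F: "F \<subseteq> \<Union>\<B>" "F \<inter> B = {}" "X \<union> S \<subseteq> pverts G"
    "\<Union>\<B> \<subseteq> closed_nbhd G (X \<union> S)"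
    "card (X \<union> S) \<le> c * (card (D \<inter> F) + d)"
    "d \<le> 2 * w * q + card B" "q * M + card U \<le> card F + d"
    by (rule invar_query[OF assms(1,3) _ assms(5,6)]) (rule assms(4) that; assumption)+
  show ?thesis
  \<comment> \<open>With \<open>R\<close> equal to the new pending set \<open>B\<close>, the
    condition on bags meeting \<open>U - R\<close> becomes vacuous.\<close>
  proof (rule invarI[of B B \<B> F B "X \<union> S" d "q + 1"])
    show "B \<subseteq> \<Union>\<B>" using \<open>B \<in> \<B>\<close> by blast
    show "\<Union>\<B> \<subseteq> B \<union> closed_nbhd G (X \<union> S)" using F(4) by blast
    \<comment> \<open>The bag counts twice, in the boundary of this query and as the new
      \<open>R\<close>. This is the origin of the factor 2.\<close>
    show "d + card B \<le> 2 * w * (q + 1)" using F(6) B by simp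
    show "(q + 1) * M \<le> card F + d" using F(7) M by simp
  qed (use F(1-3,5) in simp_all)
qed

lemma invar_finish:
  fixes K :: nat and \<epsilon> :: real
  assumes "invar {} \<B> U S" and \<B>: "\<Union>\<B> = pverts G"
    and "\<And>v x. v \<in> pverts G \<Longrightarrow> (v, x) \<in> parcs G \<Longrightarrow> \<exists>b\<in>\<B>. v \<in> b \<and> x \<in> b"
    and "dominating_set (induced G U) X" "card X \<le> c * domination_number (induced G U)"
    and M: "M = K * w * (max_degree G + 1)" and "w > 0"
    and \<epsilon>: "\<epsilon> > 0" and K: "K \<ge> 2 + 2 / \<epsilon>"
  shows "dominating_set G (X \<union> S)" "card (X \<union> S) \<le> c * (1 + \<epsilon>) * card D"
proof -
  obtain F d q where F: "F \<subseteq> \<Union>\<B>" "X \<union> S \<subseteq> pverts G"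
    "\<Union>\<B> \<subseteq> closed_nbhd G (X \<union> S)"
    "card (X \<union> S) \<le> c * (card (D \<inter> F) + d)"
    "d \<le> 2 * w * q + card ({} :: 'a set)" "q * M + card U \<le> card F + d"
    using assms(1) _ _ assms(4,5) by (rule invar_query) (use assms(2,3) in auto)
  show "dominating_set G (X \<union> S)"
    using F(2,3) \<B> in_arcsD2 unfolding dominating_set_def by (auto simp: closed_nbhd_def)
  let ?\<Delta> = "max_degree G + 1"
  have "card F \<le> card D * ?\<Delta>"
    using card_verts_le_dominating_set[OF G D] card_mono[OF pair_finite_verts, of F] F(1) \<B>
    by simp
  \<comment> \<open>Each of the \<open>q\<close> cuts has used up \<open>M\<close> vertices, all
    counted by \<open>card F + d\<close>; the empty bag adds nothing to the bound
    \<open>2 * w * q\<close> on \<open>d\<close>.\<close>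
  with F(5,6) have "q * M \<le> card D * ?\<Delta> + 2 * w * q" by simp
  then have "real (q * M) \<le> card D * ?\<Delta> + 2 * w * q"
    by (simp only: of_nat_le_iff)
  then have "real q * (real K * w * ?\<Delta>) \<le> card D * real ?\<Delta> + 2 * real w * q"
    unfolding M by (simp only: of_nat_mult of_nat_add of_nat_numeral)
  \<comment> \<open>This weakening makes \<open>\<Delta> + 1\<close> a common factor, which can then
    be cancelled.\<close>
  moreover have "2 * real w * q \<le> 2 * real w * q * ?\<Delta>"
    using mult_left_mono[of 1 "real ?\<Delta>" "2 * real w * q"] by simp
  moreover have "(q * (real K - 2) * w) * ?\<Delta> = real q * (real K * w * ?\<Delta>) - 2 * real w * q * ?\<Delta>"
    by (simp add: algebra_simps)
  ultimately have "(q * (real K - 2) * w) * ?\<Delta> \<le> card D * real ?\<Delta>"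
    by linarith
  then have "q * (real K - 2) * w \<le> card D"
    by (subst (asm) mult_le_cancel_right_pos) auto
  \<comment> \<open>Here the choice of \<open>K\<close> enters, through
    \<open>K - 2 \<ge> 2 / \<epsilon>\<close>.\<close>
  moreover have "2 / \<epsilon> * (q * w) \<le> (real K - 2) * (q * w)"
    using K by (intro mult_right_mono) auto
  ultimately have "2 / \<epsilon> * (q * w) \<le> card D" by (simp add: algebra_simps)
  then have "2 * real w * q \<le> \<epsilon> * card D"
    using \<epsilon> by (simp add: field_simps)
  moreover have "real d \<le> 2 * real w * q"
    using F(5) by (metis add.right_neutral card.empty of_nat_le_iff of_nat_mult of_nat_numeral)
  ultimately have "real d \<le> \<epsilon> * card D" by linarith
  moreover have "card (D \<inter> F) \<le> card D"
    using D finite_subset[OF _ pair_finite_verts] by (auto simp: dominating_set_def intro: card_mono)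
  ultimately have "real (card (D \<inter> F)) + d \<le> (1 + \<epsilon>) * card D"
    by (simp add: algebra_simps)
  with c have "c * (card (D \<inter> F) + d) \<le> c * ((1 + \<epsilon>) * card D)"
    by (simp add: mult_left_mono)
  with F(4) show "card (X \<union> S) \<le> c * (1 + \<epsilon>) * card D"
    by (simp add: mult.assoc)
qed

end

section \<open>Separation in rooted tree decompositions\<close>

lemma nodes_Node: "nodes (Node b ts) = insert [] (\<Union>i<length ts. (#) i ` nodes (ts ! i))"
  by (simp cong: SUP_cong_simp)

declare nodes.simps [simp del]

lemma node_label_simps [simp]:
  "node_label t [] = label t" "node_label (Node b ts) (i # p) = node_label (ts ! i) p"
  by (simp_all add: node_label_def)

lemma node_label_image: "node_label t ` nodes t = set_rtree t"
proof (induction t)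
  case (Node b ts)
  have "node_label (Node b ts) ` nodes (Node b ts)
      = insert b (\<Union>i<length ts. node_label (ts ! i) ` nodes (ts ! i))"
    by (simp add: nodes_Node image_UN image_image)
  also have "\<dots> = insert b (\<Union>i<length ts. set_rtree (ts ! i))"
    using Node by (simp cong: SUP_cong_simp)
  also have "\<dots> = set_rtree (Node b ts)"
    by (auto simp: in_set_conv_nth, metis nth_mem)
  finally show ?case .
qed

lemma finite_set_rtree: "finite (set_rtree t)"
  by (induction t) auto

lemma node_label_obtain:
  assumes "b \<in> set_rtree t"
  obtains p where "p \<in> nodes t" "b = node_label t p"
  using assms by (auto simp flip: node_label_image)

lemma bags_obtain:
  assumes "b \<in> bags ts"
  obtains i p where "i < length ts" "p \<in> nodes (ts ! i)" "b = node_label (ts ! i) p"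
proof -
  from assms obtain i where i: "i < length ts" "b \<in> set_rtree (ts ! i)"
    by (auto simp: bags_def in_set_conv_nth)
  from i(2) obtain p where "p \<in> nodes (ts ! i)" "b = node_label (ts ! i) p"
    by (rule node_label_obtain)
  with i(1) show ?thesis by (rule that)
qed

text \<open>The edge between \<open>p\<close> and \<open>p @ [i]\<close> separates the subtree below
  it from all other nodes. The condition on \<open>take\<close> says that \<open>r\<close> lies
  outside this subtree.\<close>

definition edge_separation :: "'a set rtree \<Rightarrow> bool" where
  "edge_separation t \<longleftrightarrow> (\<forall>p i q r. p @ i # q \<in> nodes t \<longrightarrow> r \<in> nodes t \<longrightarrow>
     take (length p + 1) r \<noteq> p @ [i] \<longrightarrow>
     node_label t (p @ i # q) \<inter> node_label t r \<subseteq> node_label t p \<inter> node_label t (p @ [i]))"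

text \<open>The nodes whose bags contain \<open>v\<close> are connected, so a walk among them that
  leaves the subtree must traverse its top edge.\<close>

lemma edge_separation_tree_decomposition:
  assumes "tree_decomposition G (tree_graph t) (node_label t)"
  shows "edge_separation t"
  unfolding edge_separation_def
proof (intro allI impI subsetI)
  fix p i q r v
  assume a: "p @ i # q \<in> nodes t" and r: "r \<in> nodes t" "take (length p + 1) r \<noteq> p @ [i]"
    and v: "v \<in> node_label t (p @ i # q) \<inter> node_label t r"
  let ?S = "{s \<in> pverts (tree_graph t). v \<in> node_label t s}"
  let ?H = "mk_symmetric (with_proj (tree_graph t) \<restriction> ?S)"
  have "v \<in> pverts G"
    using assms v r by (auto simp: tree_decomposition_def tree_graph_def)
  with assms have "Digraph_Component.connected (with_proj (tree_graph t) \<restriction> ?S)"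
    by (auto simp: tree_decomposition_def)
  then have "strongly_connected (with_proj ?H)"
    by (simp add: connected_def)
  moreover have "p @ i # q \<in> ?S" "r \<in> ?S"
    using a r v by (auto simp: tree_graph_def)
  ultimately have reach: "(p @ i # q) \<rightarrow>\<^sup>*\<^bsub>with_proj ?H\<^esub> r"
    by (auto simp: strongly_connected_def mk_symmetric_def)
  \<comment> \<open>Invariant along the walk: either it is still inside the subtree or both ends of
    the edge are known to carry \<open>v\<close>.\<close>
  have "take (length p + 1) r = p @ [i] \<or> p \<in> ?S \<and> p @ [i] \<in> ?S"
    using reach unfolding reachable_def
  proof (induction rule: rtrancl_on_induct)
    case base
    show ?case by simp
  next
    case (step y z)
    from step(2) have yz: "y \<in> ?S" "z \<in> ?S" "\<exists>j. z = y @ [j] \<or> y = z @ [j]"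
      by (auto simp: mk_symmetric_def tree_graph_def)
    from step.IH show ?case
    proof
      assume y: "take (length p + 1) y = p @ [i]"
      show ?thesis
      proof (cases "take (length p + 1) z = p @ [i]")
        case False
        from y have len: "length p + 1 \<le> length y"
          by (metis length_append_singleton length_take min.absorb_iff2 Suc_eq_plus1)
        from yz(3) obtain j where "z = y @ [j] \<or> y = z @ [j]" by blast
        \<comment> \<open>A step down would stay inside, so \<open>z\<close> is the parent of
          \<open>y\<close>. As \<open>z\<close> is outside, it can only be \<open>p\<close>, and
          \<open>y\<close> is \<open>p @ [i]\<close>.\<close>
        with False y len have yz': "y = z @ [j]" by auto
        with False y have "length z < length p + 1"
          by (cases "length p + 1 \<le> length z") auto
        with len yz' have "length z = length p" by simp
        with y yz' have "z = p" "j = i" by auto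
        with yz yz' show ?thesis by simp
      qed simp
    qed simp
  qed
  with r show "v \<in> node_label t p \<inter> node_label t (p @ [i])" by simp
qed

lemma edge_separation_child:
  assumes "edge_separation (Node b ts)" "i < length ts"
  shows "edge_separation (ts ! i)"
  unfolding edge_separation_def
proof (intro allI impI)
  fix p j q r
  assume a: "p @ j # q \<in> nodes (ts ! i)" "r \<in> nodes (ts ! i)" "take (length p + 1) r \<noteq> p @ [j]"
  have "(i # p) @ j # q \<in> nodes (Node b ts)" "i # r \<in> nodes (Node b ts)"
    "take (length (i # p) + 1) (i # r) \<noteq> (i # p) @ [j]"
    using a assms(2) by (auto simp: nodes_Node)
  with assms(1) have "node_label (Node b ts) ((i # p) @ j # q) \<inter> node_label (Node b ts) (i # r)
      \<subseteq> node_label (Node b ts) (i # p) \<inter> node_label (Node b ts) ((i # p) @ [j])"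
    unfolding edge_separation_def by blast
  then show "node_label (ts ! i) (p @ j # q) \<inter> node_label (ts ! i) r
      \<subseteq> node_label (ts ! i) p \<inter> node_label (ts ! i) (p @ [j])"
    by simp
qed

text \<open>Separation in the form used by the forest recursion: \<open>b\<close> is the bag of the
  common parent and is grouped with the later siblings.\<close>

fun separated :: "'a set \<Rightarrow> 'a set rtree list \<Rightarrow> bool" where
  "separated b [] \<longleftrightarrow> True"
| "separated b (Node c us # ts) \<longleftrightarrow>
     \<Union>(insert c (bags us)) \<inter> \<Union>(insert b (bags ts)) \<subseteq> b \<inter> c \<and>
     separated c us \<and> separated b ts"

lemma edge_separation_separated:
  "edge_separation t \<Longrightarrow> separated (label t) (children t)"
proof (induction t)
  case (Node b ts)
  have "separated b (drop k ts)" if "k \<le> length ts" for k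
    using that
  proof (induction k rule: inc_induct)
    case base
    show ?case by simp
  next
    case (step k)
    obtain c us where t: "ts ! k = Node c us" by (cases "ts ! k")
    have drop: "drop k ts = Node c us # drop (Suc k) ts"
      using step(2) t by (simp add: Cons_nth_drop_Suc flip: t)
    have "separated c us"
      using Node.IH[OF nth_mem edge_separation_child[OF Node.prems]] step(2) t
      by (metis rtree.sel)
    moreover have "\<Union>(insert c (bags us)) \<inter> \<Union>(insert b (bags (drop (Suc k) ts))) \<subseteq> b \<inter> c"
    proof
      fix v assume v: "v \<in> \<Union>(insert c (bags us)) \<inter> \<Union>(insert b (bags (drop (Suc k) ts)))"
      then obtain d where "d \<in> set_rtree (ts ! k)" "v \<in> d"
        by (auto simp: t bags_def)
      then obtain q where q: "q \<in> nodes (ts ! k)" "v \<in> node_label (ts ! k) q"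
        by (auto elim: node_label_obtain)
      \<comment> \<open>The node outside the \<open>k\<close>-th subtree is the root or, if its bag
        lacks \<open>v\<close>, a node below a later sibling.\<close>
      have "\<exists>r\<in>nodes (Node b ts). take 1 r \<noteq> [k] \<and> v \<in> node_label (Node b ts) r"
      proof (cases "v \<in> b")
        case True
        then show ?thesis by (intro bexI[of _ "[]"]) (auto simp: nodes_Node)
      next
        case False
        with v obtain d where "d \<in> bags (drop (Suc k) ts)" "v \<in> d" by blast
        then obtain i r where "i < length (drop (Suc k) ts)" "r \<in> nodes (drop (Suc k) ts ! i)"
          "v \<in> node_label (drop (Suc k) ts ! i) r"
          by (auto elim: bags_obtain)
        then show ?thesis
          by (intro bexI[of _ "(Suc k + i) # r"]) (auto simp: nodes_Node)
      qed
      then obtain r where r: "r \<in> nodes (Node b ts)" "take 1 r \<noteq> [k]" "v \<in> node_label (Node b ts) r"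
        by blast
      have "[] @ k # q \<in> nodes (Node b ts)"
        using q step(2) by (auto simp: nodes_Node)
      with Node.prems r(1,2)
      have "node_label (Node b ts) ([] @ k # q) \<inter> node_label (Node b ts) r
          \<subseteq> node_label (Node b ts) [] \<inter> node_label (Node b ts) ([] @ [k])"
        unfolding edge_separation_def by (metis add_0 list.size(3) append_Nil)
      with q(2) r(3) t show "v \<in> b \<inter> c" by auto
    qed
    ultimately show ?case
      using step.IH by (simp add: drop)
  qed
  from this[of 0] show ?case by simp
qed

section \<open>Correctness of the program\<close>

abbreviation set_trees :: "'a list rtree list \<Rightarrow> 'a set rtree list" where
  "set_trees \<equiv> map (map_rtree set)"

lemma bags_set_trees: "bags (set_trees ts) = set ` bags ts"
  by (auto simp: bags_def rtree.set_map)

lemma encodes_set_list: "distinct xs \<Longrightarrow> encodes_set enc (enc_list (map enc xs)) (set xs)"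
  by (auto simp: encodes_set_def)

text \<open>Queries of up to \<open>2 * M\<close> vertices are allowed because a merge unites two
  pending sets smaller than \<open>M\<close>. By \<open>w < M\<close>, the bag kept by a cut is
  below the threshold again.\<close>

locale kernel_instance =
  kernel_run K orc Q N + domination_instance G D c w M
  for K :: nat and orc :: "data \<Rightarrow> data" and Q :: "data set" and N :: nat
    and G :: "nat pair_pre_digraph" and D :: "nat set" and c :: real and w M :: nat +
  fixes V A m :: data and s :: nat
  assumes V: "enc_set V (pverts G)" and A: "encodes_set enc_arc A (parcs G)"
    and m: "len m = M" and w: "w < M"
    and N: "N = 310 * (s + 1) ^ 2" and size_V: "size V \<le> s" and size_A: "size A \<le> s"
    and answers: "\<And>u U. enc_set u U \<Longrightarrow> U \<subseteq> pverts G \<Longrightarrow> card U \<le> 2 * M \<Longrightarrow>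
      query A u \<in> Q \<and> approx_solution c (induced G U) (orc (query A u))"
begin

lemma size_vertex_set: "enc_set u U \<Longrightarrow> U \<subseteq> pverts G \<Longrightarrow> size u \<le> s"
  by (rule le_trans[OF size_encodes_set_mono[OF _ V] size_V])

lemma oracle_answer:
  assumes "enc_set u U" "U \<subseteq> pverts G" "card U \<le> 2 * M"
  obtains X where "query A u \<in> Q" "enc_set (orc (query A u)) X" "X \<subseteq> U"
    "dominating_set (induced G U) X" "card X \<le> c * domination_number (induced G U)"
    "size (orc (query A u)) \<le> s"
proof -
  from answers[OF assms] obtain X where X: "query A u \<in> Q" "enc_set (orc (query A u)) X"
    "dominating_set (induced G U) X" "card X \<le> c * domination_number (induced G U)"
    by (auto simp: approx_solution_def)
  from X(3) have XU: "X \<subseteq> U" by (simp add: dominating_set_def)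
  with assms(2) have "X \<subseteq> pverts G" by (rule order_trans[rotated])
  from that[OF X(1,2) XU X(3,4) size_vertex_set[OF X(2) this]] show ?thesis .
qed

section \<open>Correctness of the forest recursion\<close>

definition good_result :: "nat set \<Rightarrow> nat set set \<Rightarrow> data \<Rightarrow> bool" where
  "good_result B \<B> r \<longleftrightarrow> (\<exists>U S. enc_set (data_fst r) U \<and> enc_set (data_snd r) S \<and>
     card U < M \<and> invar B \<B> U S)"

text \<open>Vertices of the current bag are exempt, since bags not yet processed may be the only
  ones covering their arcs.\<close>

definition arcs_covered :: "nat set \<Rightarrow> nat set set \<Rightarrow> bool" where
  "arcs_covered B \<B> \<longleftrightarrow>
     (\<forall>v\<in>\<Union>\<B> - B. \<forall>x. (v, x) \<in> parcs G \<longrightarrow> (\<exists>b\<in>\<B>. v \<in> b \<and> x \<in> b))"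

lemma good_result_merge:
  assumes r: "good_result C \<C> r" "good_result B \<B> r'"
    and \<B>: "B \<in> \<B>" "\<Union>\<C> \<union> \<Union>\<B> \<subseteq> pverts G"
    and sep: "\<Union>\<C> \<inter> \<Union>\<B> \<subseteq> B \<inter> C"
    and arcs: "arcs_covered B (\<C> \<union> \<B>)"
    and B: "enc_set b B" "card B \<le> w"
    and u_def: "u = union_list (data_fst r) (data_fst r')"
  shows "good_result B (\<C> \<union> \<B>) (merge A m b r r')" "query A u \<in> Q"
    "merge_time A r r' + 50 \<le> N"
proof -
  from r(1) obtain U S where 1: "enc_set (data_fst r) U" "enc_set (data_snd r) S"
    "card U < M" "invar C \<C> U S"
    by (auto simp: good_result_def)
  from r(2) obtain U' S' where 2: "enc_set (data_fst r') U'" "enc_set (data_snd r') S'"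
    "card U' < M" "invar B \<B> U' S'"
    by (auto simp: good_result_def)
  note union = encodes_set_union_list[OF inj_enc_nat]
  let ?s = "union_list (data_snd r) (data_snd r')"
  have u: "enc_set u (U \<union> U')" and s: "enc_set ?s (S \<union> S')"
    unfolding u_def using 1(1,2) 2(1,2) by (auto intro: union)
  have inv: "invar B (\<C> \<union> \<B>) (U \<union> U') (S \<union> S')"
    using 1(4) 2(4) \<B>(2) sep by (rule invar_merge)
  have sub: "U \<subseteq> pverts G" "S \<subseteq> pverts G" "U' \<subseteq> pverts G" "S' \<subseteq> pverts G"
    using invar_pending[OF 1(4)] invar_pending[OF 2(4)] \<B>(2) by blast+
  have sub': "U \<union> U' \<subseteq> pverts G" "S \<union> S' \<subseteq> pverts G" using sub by blast+
  have "card (U \<union> U') \<le> 2 * M"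
    using 1(3) 2(3) card_Un_le[of U U'] by linarith
  with u sub'(1) obtain X where X: "query A u \<in> Q"
    "enc_set (orc (query A u)) X" "dominating_set (induced G (U \<union> U')) X"
    "card X \<le> c * domination_number (induced G (U \<union> U'))" "size (orc (query A u)) \<le> s"
    by (rule oracle_answer) (rule that)
  show "query A u \<in> Q" by (fact X(1))
  show "merge_time A r r' + 50 \<le> N"
    unfolding N
    by (rule merge_time_le[OF size_A size_vertex_set[OF 1(1) sub(1)] size_vertex_set[OF 2(1) sub(3)]
        size_vertex_set[OF 1(2) sub(2)] size_vertex_set[OF 2(2) sub(4)] u_def
        size_vertex_set[OF u sub'(1)] size_vertex_set[OF s sub'(2)] X(5)])
  show "good_result B (\<C> \<union> \<B>) (merge A m b r r')"
  proof (cases "M \<le> card (U \<union> U')")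
    case True
    have "merge A m b r r' = Cell b (union_list (orc (query A u)) ?s)"
      unfolding merge_def cut_def u_def using True by (simp add: m len_encodes_set[OF u[unfolded u_def]])
    moreover have "invar B (\<C> \<union> \<B>) B (X \<union> (S \<union> S'))"
    proof (rule invar_cut[OF inv _ _ _ X(3,4) True B(2)])
      show "B \<in> \<C> \<union> \<B>" "\<Union>(\<C> \<union> \<B>) \<subseteq> pverts G" using \<B> by auto
      show "\<exists>b\<in>\<C> \<union> \<B>. v \<in> b \<and> x \<in> b" if "v \<in> \<Union>(\<C> \<union> \<B>) - B" "(v, x) \<in> parcs G" for v x
        using arcs that unfolding arcs_covered_def by blast
    qed
    ultimately show ?thesis
      unfolding good_result_def using B w union[OF X(2) s]
      by (intro exI[of _ B] exI[of _ "X \<union> (S \<union> S')"]) simp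
  next
    case False
    have "merge A m b r r' = Cell u ?s"
      unfolding merge_def cut_def u_def using False by (simp add: m len_encodes_set[OF u[unfolded u_def]])
    with False u s inv show ?thesis
      unfolding good_result_def by (intro exI[of _ "U \<union> U'"] exI[of _ "S \<union> S'"]) simp
  qed
qed

text \<open>Outside the shared bags, a vertex of one side occurs in no bag of the other, so the bag
  covering its arc is on its own side.\<close>

lemma arcs_covered_split:
  assumes "arcs_covered B (\<C> \<union> \<B>)" "\<Union>\<C> \<inter> \<Union>\<B> \<subseteq> B \<inter> C" "B \<in> \<B>"
  shows "arcs_covered C \<C>" "arcs_covered B \<B>"
proof -
  have *: "\<exists>b\<in>\<C> \<union> \<B>. v \<in> b \<and> x \<in> b" if "v \<in> \<Union>(\<C> \<union> \<B>)" "v \<notin> B" "(v, x) \<in> parcs G" for v x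
    using assms(1) that unfolding arcs_covered_def by blast
  have "\<exists>b\<in>\<C>. v \<in> b \<and> x \<in> b" if v: "v \<in> \<Union>\<C> - C" and vx: "(v, x) \<in> parcs G" for v x
  proof -
    from v assms(2) have nB: "v \<notin> \<Union>\<B>" by blast
    with assms(3) have "v \<notin> B" by blast
    moreover from v have "v \<in> \<Union>(\<C> \<union> \<B>)" by blast
    ultimately obtain b where b: "b \<in> \<C> \<union> \<B>" "v \<in> b" "x \<in> b" using *[OF _ _ vx] by blast
    with nB have "b \<in> \<C>" by blast
    with b show ?thesis by blast
  qed
  then show "arcs_covered C \<C>" unfolding arcs_covered_def by blast
  have "\<exists>b\<in>\<B>. v \<in> b \<and> x \<in> b" if v: "v \<in> \<Union>\<B> - B" and vx: "(v, x) \<in> parcs G" for v x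
  proof -
    from v assms(2) have nC: "v \<notin> \<Union>\<C>" by blast
    from v have "v \<in> \<Union>(\<C> \<union> \<B>)" "v \<notin> B" by blast+
    then obtain b where b: "b \<in> \<C> \<union> \<B>" "v \<in> b" "x \<in> b" using *[OF _ _ vx] by blast
    with nC have "b \<in> \<B>" by blast
    with b show ?thesis by blast
  qed
  then show "arcs_covered B \<B>" unfolding arcs_covered_def by blast
qed

lemma good_result_init:
  assumes "enc_set b B" "card B < M"
  shows "good_result B {B} (Cell b Atom)"
  unfolding good_result_def using assms invar_init[of B]
  by (intro exI[of _ B] exI[of _ "{}"]) simp

text \<open>Time and correctness share one induction, because the bound \<open>N\<close> on a merge
  and the admissibility of its query rest on both partial results being good.\<close>

lemma process_correct:
  assumes "separated (set b) (set_trees ts)"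
    and "\<And>l. l \<in> insert b (bags ts) \<Longrightarrow> distinct l \<and> length l \<le> w \<and> set l \<subseteq> pverts G"
    and "arcs_covered (set b) (set ` insert b (bags ts))"
  shows "callable 14 [A, m, enc_list (map enc_nat b), enc_forest ts] \<and>
    good_result (set b) (set ` insert b (bags ts)) (process A m (enc_list (map enc_nat b)) (enc_forest ts))"
  using assms
proof (induction ts arbitrary: b rule: forest_induct)
  case Nil
  have b: "distinct b" "length b \<le> w" using Nil(2)[of b] by simp_all
  then have "card (set b) < M"
    using w card_length[of b] by linarith
  from good_result_init[OF encodes_set_list[OF b(1)] this]
  have "good_result (set b) {set b} (Cell (enc_list (map enc_nat b)) Atom)" .
  moreover have "10 \<le> N" unfolding N by simp
  ultimately show ?case
    using callable_process_Atom by simp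
next
  case (Cons a us ts)
  let ?enc = "\<lambda>l. enc_list (map enc_nat l)"
  define \<C> where "\<C> = set ` insert a (bags us)"
  define \<B> where "\<B> = set ` insert b (bags ts)"
  let ?r = "process A m (?enc a) (enc_forest us)" and ?r' = "process A m (?enc b) (enc_forest ts)"
  from Cons.prems(1) have sep: "\<Union>\<C> \<inter> \<Union>\<B> \<subseteq> set b \<inter> set a"
    and sep': "separated (set a) (set_trees us)" "separated (set b) (set_trees ts)"
    by (simp_all only: list.map rtree.map separated.simps bags_set_trees \<C>_def \<B>_def image_insert)
  have Un: "set ` insert b (bags (Node a us # ts)) = \<C> \<union> \<B>"
    unfolding \<C>_def \<B>_def bags_simps by blast
  have "set b \<in> \<B>" by (simp add: \<B>_def)
  note arcs = Cons.prems(3)[unfolded Un]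
  note split = arcs_covered_split[OF arcs sep \<open>set b \<in> \<B>\<close>]
  have bags: "insert a (bags us) \<subseteq> insert b (bags (Node a us # ts))"
    "insert b (bags ts) \<subseteq> insert b (bags (Node a us # ts))"
    unfolding bags_simps by blast+
  have IH1: "callable 14 [A, m, ?enc a, enc_forest us]" "good_result (set a) \<C> ?r"
    using Cons.IH(1)[OF sep'(1) Cons.prems(2)[OF subsetD[OF bags(1)]] split(1)[unfolded \<C>_def]]
    unfolding \<C>_def by blast+
  have IH2: "callable 14 [A, m, ?enc b, enc_forest ts]" "good_result (set b) \<B> ?r'"
    using Cons.IH(2)[OF sep'(2) Cons.prems(2)[OF subsetD[OF bags(2)]] split(2)[unfolded \<B>_def]]
    unfolding \<B>_def by blast+
  have "distinct b" "length b \<le> w"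
    using Cons.prems(2)[of b] by simp_all
  from this(2) have "card (set b) \<le> w"
    using card_length[of b] by linarith
  note b = encodes_set_list[OF \<open>distinct b\<close>] this
  have "\<Union>(\<C> \<union> \<B>) \<subseteq> pverts G"
    unfolding Un[symmetric] using Cons.prems(2) by (simp only: Union_least ball_simps subset_iff UN_iff) blast
  then have sub: "\<Union>\<C> \<union> \<Union>\<B> \<subseteq> pverts G" by (simp only: Union_Un_distrib)
  note merge = good_result_merge[OF IH1(2) IH2(2) \<open>set b \<in> \<B>\<close> sub sep arcs b refl]
  have forest: "enc_forest (Node a us # ts) = Cell (Cell (?enc a) (enc_forest us)) (enc_forest ts)"
    by simp
  have "callable 14 [A, m, ?enc b, enc_forest (Node a us # ts)]"
    unfolding forest by (rule callable_process_Cell[OF IH1(1) IH2(1) merge(2,3) refl])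
  moreover have "process A m (?enc b) (enc_forest (Node a us # ts)) = merge A m (?enc b) ?r ?r'"
    unfolding forest by (simp only: process.simps data_fst.simps data_snd.simps)
  ultimately show ?case
    unfolding Un using merge(1) by (simp only:)
qed

lemma main_correct:
  fixes \<epsilon> :: real and t' :: "nat list rtree"
  defines "t \<equiv> enc_rtree (\<lambda>l. enc_list (map enc_nat l)) t'"
  assumes "A \<noteq> Atom" and m_def: "m = threshold K (Cell V A) (Cell t Atom)"
    and "edge_separation (map_rtree set t')"
    and bags: "\<And>l. l \<in> set_rtree t' \<Longrightarrow> distinct l \<and> length l \<le> w"
    and verts: "\<Union>(set ` set_rtree t') = pverts G"
    and arcs: "\<And>v x. (v, x) \<in> parcs G \<Longrightarrow> \<exists>l\<in>set_rtree t'. v \<in> set l \<and> x \<in> set l"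
    and s: "s = size (Cell (Cell V A) t)"
    and M: "M = K * w * (max_degree G + 1)" "w > 0" and \<epsilon>: "\<epsilon> > 0" "K \<ge> 2 + 2 / \<epsilon>"
    and D: "card D = domination_number G"
  shows "computes [Cell (Cell V A) t] (kernel_program K ! 0) (main (Cell (Cell V A) t))
      ((40 * K + 2000) * (s + 1) ^ 3)"
    and "approx_solution (c * (1 + \<epsilon>)) G (main (Cell (Cell V A) t))"
proof -
  \<comment> \<open>The tree is processed as a forest below an additional empty bag, encoded as
    \<open>Atom\<close>, so the final query starts from \<open>invar {}\<close>.\<close>
  let ?\<B> = "insert {} (set ` set_rtree t')"
  have t: "enc_forest [t'] = Cell t Atom" by (simp add: t_def)
  have bags': "bags [t'] = set_rtree t'" by (simp add: bags_def)
  obtain a us where t': "t' = Node a us" by (cases t')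
  have "separated {} (set_trees [t'])"
    using edge_separation_separated[OF assms(4)] by (simp add: t')
  moreover have "\<And>l. l \<in> insert [] (bags [t']) \<Longrightarrow> distinct l \<and> length l \<le> w \<and> set l \<subseteq> pverts G"
    unfolding bags' using bags verts by auto
  moreover have "arcs_covered {} ?\<B>"
    unfolding arcs_covered_def using arcs by blast
  ultimately have proc: "callable 14 [A, m, Atom, Cell t Atom]"
    "good_result {} ?\<B> (process A m Atom (Cell t Atom))"
    using process_correct[of "[]" "[t']"] unfolding t bags' by simp_all
  let ?r = "process A m Atom (Cell t Atom)"
  from proc(2) obtain U S where U: "enc_set (data_fst ?r) U" "enc_set (data_snd ?r) S"
    "card U < M" "invar {} ?\<B> U S"
    unfolding good_result_def by blast
  have sub: "U \<subseteq> pverts G" "S \<subseteq> pverts G"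
    using invar_pending[OF U(4)] verts by auto
  have "card U \<le> 2 * M" using U(3) by simp
  with U(1) sub(1) obtain X where X: "query A (data_fst ?r) \<in> Q"
    "enc_set (orc (query A (data_fst ?r))) X" "dominating_set (induced G U) X"
    "card X \<le> c * domination_number (induced G U)" "size (orc (query A (data_fst ?r))) \<le> s"
    by (rule oracle_answer) (rule that)
  have main: "main (Cell (Cell V A) t) = finish A ?r"
    using \<open>A \<noteq> Atom\<close> by (simp add: main_def Let_def m_def del: process.simps)
  show "computes [Cell (Cell V A) t] (kernel_program K ! 0) (main (Cell (Cell V A) t))
      ((40 * K + 2000) * (s + 1) ^ 3)"
    unfolding s
    by (rule computes_mono[OF
          computes_main[OF \<open>A \<noteq> Atom\<close> proc(1)[unfolded m_def] X(1)[unfolded m_def]]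
          main_time_le[OF N[unfolded s] size_vertex_set[OF U(1) sub(1), unfolded s m_def]
            size_vertex_set[OF U(2) sub(2), unfolded s m_def] X(5)[unfolded s m_def]]])
  have \<B>: "\<Union>?\<B> = pverts G"
    using verts by simp
  have cover: "\<exists>b\<in>?\<B>. v \<in> b \<and> x \<in> b" if "(v, x) \<in> parcs G" for v x
    using arcs[OF that] by blast
  have "dominating_set G (X \<union> S)" "card (X \<union> S) \<le> c * (1 + \<epsilon>) * card D"
    using invar_finish[OF U(4) \<B> cover X(3,4) M \<epsilon>] by (simp_all only:)
  then show "approx_solution (c * (1 + \<epsilon>)) G (main (Cell (Cell V A) t))"
    unfolding approx_solution_def main finish_def D[symmetric]
    using encodes_set_union_list[OF inj_enc_nat X(2) U(2)] by blast
qed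

end

section \<open>From an encoded input to the bounds on queries and solution\<close>

lemma encodes_graph_induced:
  assumes "enc_set u U" "encodes_set enc_arc A (parcs G)"
  shows "encodes_graph (query A u) (induced G U)"
  using assms encodes_set_induced_arcs[OF assms(2,1)] by (auto simp: encodes_graph_def)

lemma domination_number_edgeless:
  assumes "pair_graph G" "parcs G = {}"
  shows "dominating_set G (pverts G)" "domination_number G = card (pverts G)"
proof -
  show "dominating_set G (pverts G)"
    using assms(2) by (simp add: dominating_set_def closed_nbhd_def)
  from domination_number_attained[OF assms(1)] obtain X where
    "dominating_set G X" "card X = domination_number G" by blast
  with assms(2) show "domination_number G = card (pverts G)"
    by (simp add: dominating_set_def closed_nbhd_def)
qed

lemma run_kernel_program:
  fixes \<epsilon> c :: real and K :: nat
  defines "b \<equiv> \<lambda>tw \<Delta>. 24 * ((1 + \<epsilon>) / \<epsilon>) * real tw * real \<Delta>"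
  assumes \<epsilon>: "\<epsilon> > 0" and K: "K = nat \<lceil>2 + 2 / \<epsilon>\<rceil>"
    and G: "pair_graph G" and t: "nice_tree_decomposition G t"
    and width: "decomposition_width (tree_graph t) (node_label t) = treewidth G"
    and x: "encodes_input x G t" and c: "c \<ge> 1"
    and orc: "approx_oracle c (b (treewidth G) (max_degree G)) orc"
  shows "\<exists>y k qs. run (kernel_program K) orc x y k qs \<and>
    k \<le> (40 * K + 2000) * (size x + 1) ^ 3 \<and>
    (\<forall>q\<in>set qs. \<exists>H. bounded_query (b (treewidth G) (max_degree G)) q H) \<and>
    approx_solution (c * (1 + \<epsilon>)) G y"
proof -
  interpret pair_graph G by fact
  let ?b = "b (treewidth G) (max_degree G)"
  define Q where "Q = {q. \<exists>H. bounded_query ?b q H}"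
  define s where "s = size x"
  interpret run: kernel_run K orc Q "310 * (s + 1) ^ 2" .
  from x obtain V A dt where x_eq: "x = Cell (Cell V A) dt"
    and V: "enc_set V (pverts G)" and A: "encodes_set enc_arc A (parcs G)"
    and dt: "encodes_bag_tree dt t"
    by (auto simp: encodes_input_def encodes_graph_def)
  from dt obtain t' :: "nat list rtree" where t': "map_rtree set t' = t"
    "\<forall>xs\<in>set_rtree t'. distinct xs" "dt = enc_rtree (\<lambda>xs. enc_list (map enc_nat xs)) t'"
    by (auto simp: encodes_bag_tree_def)
  have "\<exists>y T. run.computes [x] (kernel_program K ! 0) y T \<and> T \<le> (40 * K + 2000) * (s + 1) ^ 3 \<and>
    approx_solution (c * (1 + \<epsilon>)) G y"
  proof (cases "A = Atom")
    case True
    with A have E: "parcs G = {}" by simp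
    have "run.main x = V" unfolding x_eq True by (simp add: run.main_def)
    then have "run.computes [x] (kernel_program K ! 0) V 10"
      using run.computes_main_edgeless[of V dt] unfolding x_eq True by simp
    moreover have "10 \<le> (40 * K + 2000) * (s + 1) ^ 3"
      using mult_le_mono[of 10 "40 * K + 2000" 1 "(s + 1) ^ 3"] by simp
    moreover have "1 * real (card (pverts G)) \<le> c * (1 + \<epsilon>) * card (pverts G)"
    proof (rule mult_right_mono)
      show "1 \<le> c * (1 + \<epsilon>)" using mult_mono[of 1 c 1 "1 + \<epsilon>"] c \<epsilon> by simp
    qed simp
    then have "approx_solution (c * (1 + \<epsilon>)) G V"
      unfolding approx_solution_def using V domination_number_edgeless[OF G E] by auto
    ultimately show ?thesis by blast
  next
    case False
    have td: "tree_decomposition G (tree_graph t) (node_label t)"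
      using t by (simp add: nice_tree_decomposition_def)
    have nodes: "node_label t ` pverts (tree_graph t) = set ` set_rtree t'"
      by (simp add: tree_graph_def node_label_image rtree.set_map flip: t'(1))
    have verts: "\<Union>(set ` set_rtree t') = pverts G"
      using td by (simp add: tree_decomposition_def flip: nodes)
    have arcs: "\<exists>l\<in>set_rtree t'. v \<in> set l \<and> u \<in> set l" if "(v, u) \<in> parcs G" for v u
    proof -
      from td that obtain p where "p \<in> pverts (tree_graph t)" "v \<in> node_label t p" "u \<in> node_label t p"
        by (fastforce simp: tree_decomposition_def)
      moreover from this(1) nodes obtain l where "l \<in> set_rtree t'" "node_label t p = set l" by blast
      ultimately show ?thesis by auto
    qed
    define w where "w = len (max_bag (Cell dt Atom))"
    define m where "m = threshold K (Cell V A) (Cell dt Atom)"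
    define M where "M = K * w * (max_degree G + 1)"
    have w_le: "w \<le> n \<longleftrightarrow> (\<forall>l\<in>set_rtree t'. length l \<le> n)" for n
      using len_max_bag[of "[t']" n] by (simp add: w_def t'(3) bags_def)
    have len_m: "len m = M"
      unfolding m_def M_def threshold_def w_def
      by (simp add: len_repeat_list len_unary len_max_degree_in[OF V A] algebra_simps del: max_bag.simps)
    have card_bag: "card (set l) = length l" if "l \<in> set_rtree t'" for l
      using t'(2) that by (simp add: distinct_card)
    have fin: "finite (set_rtree t')" by (rule finite_set_rtree)
    \<comment> \<open>The two ends of an arc share a bag. With \<open>w \<ge> 2\<close>, the bound
      \<open>w \<le> treewidth G + 1\<close> improves to \<open>2 * treewidth G\<close>.\<close>
    have w2: "2 \<le> w"
    proof -
      from False A obtain u v where uv: "(u, v) \<in> parcs G"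
        by (cases "parcs G = {}") (auto simp: encodes_set_def)
      with arcs obtain l where l: "l \<in> set_rtree t'" "u \<in> set l" "v \<in> set l" by blast
      from uv have "u \<noteq> v" using pair_no_loops by fastforce
      then have "card {u, v} = 2" by simp
      with l have "2 \<le> card (set l)" using card_mono[of "set l" "{u, v}"] by simp
      with card_bag[OF l(1)] w_le[of w] l(1) show ?thesis by auto
    qed
    \<comment> \<open>Truncated subtraction in \<open>decomposition_width\<close> does no harm, as
      \<open>n - 1 = k\<close> implies \<open>n \<le> k + 1\<close> in any case.\<close>
    have tw: "w \<le> treewidth G + 1"
    proof -
      have "card (set l) \<le> Max (card ` set ` set_rtree t')" if "l \<in> set_rtree t'" for l
        using that fin by (intro Max_ge) auto
      then have "\<forall>l\<in>set_rtree t'. length l \<le> Max (card ` set ` set_rtree t')"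
        using card_bag by simp
      then have "w \<le> Max (card ` set ` set_rtree t')" using w_le by blast
      moreover have "Max (card ` set ` set_rtree t') - 1 = treewidth G"
        using width unfolding decomposition_width_def nodes[symmetric] by (simp add: image_image)
      ultimately show ?thesis by linarith
    qed
    \<comment> \<open>Allows \<open>\<Delta> + 1\<close> to be replaced by
      \<open>2 * \<Delta>\<close>.\<close>
    have deg: "1 \<le> max_degree G"
    proof -
      from False A obtain u v where uv: "(u, v) \<in> parcs G"
        by (cases "parcs G = {}") (auto simp: encodes_set_def)
      then have "{v} \<subseteq> {v. (u, v) \<in> parcs G}" "finite {v. (u, v) \<in> parcs G}"
        using finite_subset[OF _ pair_finite_verts, of "{v. (u, v) \<in> parcs G}"] in_arcsD2 by auto
      from card_mono[OF this(2,1)] card_nbhd_le_max_degree[OF G in_arcsD1[OF uv]] show ?thesis by simp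
    qed
    have K_ge: "2 + 2 / \<epsilon> \<le> K" unfolding K by (rule real_nat_ceiling_ge)
    have "real_of_int \<lceil>2 + 2 / \<epsilon>\<rceil> \<le> 3 + 2 / \<epsilon>"
      using ceiling_correct[of "2 + 2 / \<epsilon>"] by linarith
    moreover have "- 1 < 2 + 2 / \<epsilon>"
      using divide_pos_pos[of 2 \<epsilon>] \<epsilon> by linarith
    then have "0 \<le> \<lceil>2 + 2 / \<epsilon>\<rceil>" by (simp only: zero_le_ceiling)
    ultimately have "K \<le> 3 + 2 / \<epsilon>" unfolding K by simp
    also have "\<dots> \<le> 3 * ((1 + \<epsilon>) / \<epsilon>)" using \<epsilon> by (simp add: field_simps)
    finally have K_le: "K \<le> 3 * ((1 + \<epsilon>) / \<epsilon>)" .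
    have "2 < real K" using K_ge \<epsilon> by (smt (verit) divide_pos_pos)
    then have "3 \<le> K" by linarith
    have "3 * w * 1 \<le> K * w * (max_degree G + 1)"
      using \<open>3 \<le> K\<close> by (intro mult_le_mono) auto
    then have wM: "w < M" unfolding M_def using w2 by linarith
    \<comment> \<open>24 is the product of 2 from \<open>2 * M\<close>, 3 from the bound on
      \<open>K\<close>, and 2 each from \<open>w \<le> 2 * treewidth G\<close> and
      \<open>\<Delta> + 1 \<le> 2 * \<Delta>\<close>.\<close>
    have bound: "real (2 * M) \<le> ?b"
    proof -
      have "w \<le> 2 * treewidth G" using tw w2 by linarith
      then have "w * (max_degree G + 1) \<le> (2 * treewidth G) * (2 * max_degree G)"
        using deg by (intro mult_le_mono) auto
      then have "real (w * (max_degree G + 1)) \<le> 4 * (real (treewidth G) * max_degree G)"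
        using of_nat_mono by fastforce
      with K_le have "real K * real (w * (max_degree G + 1))
          \<le> (3 * ((1 + \<epsilon>) / \<epsilon>)) * (4 * (real (treewidth G) * max_degree G))"
        using \<epsilon> by (intro mult_mono) auto
      moreover have "real (2 * M) = 2 * (real K * real (w * (max_degree G + 1)))"
        by (simp only: M_def of_nat_mult of_nat_numeral mult.assoc)
      moreover have "24 * e * x * y = 2 * ((3 * e) * (4 * (x * y)))" for e x y :: real
        by simp
      ultimately show ?thesis unfolding b_def by linarith
    qed
    obtain D where D: "dominating_set G D" "card D = domination_number G"
      using domination_number_attained[OF G] by blast
    have answers: "query A u \<in> Q \<and> approx_solution c (induced G U) (orc (query A u))"
      if "enc_set u U" "U \<subseteq> pverts G" "card U \<le> 2 * M" for u U
    proof -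
      have "real (card U) \<le> ?b" using that(3) bound by (meson of_nat_mono order_trans)
      then have "bounded_query ?b (query A u) (induced G U)"
        using pair_graph_induced[OF G that(2)] encodes_graph_induced[OF that(1) A]
        by (simp add: bounded_query_def)
      with orc show ?thesis unfolding Q_def approx_oracle_def by blast
    qed
    interpret inst: kernel_instance K orc Q "310 * (s + 1) ^ 2" G D c w M V A m s
      using G D(1) c V A len_m wM answers
      by unfold_locales (auto simp: s_def x_eq)
    have "edge_separation (map_rtree set t')"
      unfolding t'(1) by (rule edge_separation_tree_decomposition[OF td])
    moreover have "distinct l \<and> length l \<le> w" if "l \<in> set_rtree t'" for l
      using t'(2) w_le[of w] that by blast
    moreover have "s = size (Cell (Cell V A) dt)" by (simp add: s_def x_eq)
    moreover have "w > 0" using w2 by simp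
    ultimately have "run.computes [x] (kernel_program K ! 0) (run.main x) ((40 * K + 2000) * (s + 1) ^ 3)"
      "approx_solution (c * (1 + \<epsilon>)) G (run.main x)"
      using inst.main_correct[of t' \<epsilon>] False verts arcs \<epsilon> K_ge D(2)
      unfolding x_eq t'(3) m_def M_def by blast+
    then show ?thesis by blast
  qed
  then obtain y T k qs where "eval (kernel_program K) orc [x] (kernel_program K ! 0) y k qs"
    "k \<le> T" "T \<le> (40 * K + 2000) * (s + 1) ^ 3" "set qs \<subseteq> Q" "approx_solution (c * (1 + \<epsilon>)) G y"
    unfolding run.computes_def by blast
  moreover have "kernel_program K \<noteq> []" by (simp add: kernel_program_def)
  ultimately show ?thesis
    unfolding run_def Q_def s_def
    by (intro exI[of _ y] exI[of _ k] exI[of _ qs]) auto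
qed

theorem theorem8:
  shows "\<exists>C :: real. \<forall>\<epsilon> :: real. \<epsilon> > 0 \<longrightarrow>
    (\<exists>P. approx_turing_kernelization (1 + \<epsilon>)
       (\<lambda>tw \<Delta>. C * ((1 + \<epsilon>) / \<epsilon>) * real tw * real \<Delta>) P)"
proof (intro exI[of _ 24] allI impI)
  fix \<epsilon> :: real assume \<epsilon>: "\<epsilon> > 0"
  \<comment> \<open>\<open>K\<close> depends on \<epsilon> alone, so program and polynomial are
    fixed before \<open>c\<close> and the oracle. The polynomial \<open>[:1, 1:]\<close> is
    \<open>X + 1\<close>.\<close>
  define K where "K = nat \<lceil>2 + 2 / \<epsilon>\<rceil>"
  have poly: "poly (smult (40 * K + 2000) ([:1, 1:] ^ 3)) n = (40 * K + 2000) * (n + 1) ^ 3" for n :: nat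
    by simp
  show "\<exists>P. approx_turing_kernelization (1 + \<epsilon>)
      (\<lambda>tw \<Delta>. 24 * ((1 + \<epsilon>) / \<epsilon>) * real tw * real \<Delta>) P"
    unfolding approx_turing_kernelization_def Let_def
    by (intro exI[of _ "kernel_program K"] exI[of _ "smult (40 * K + 2000) ([:1, 1:] ^ 3)"] allI impI,
        unfold poly, elim conjE, rule run_kernel_program[OF \<epsilon> K_def])
qed

end
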